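(* Let $N=1$, $1<p<2$ and $p-1<q<\frac p2$. There exists a unique $a^*\in(0,\infty)$ such that the solution $f^*$ to $$(|f'|^{p-2}f')'(r)+\alpha f(r)+\beta r f'(r)-|f'(r)|^q=0,\qquad r>0,$$ with initial conditions $f^*(0)=a^*$ and $(f^* )'(0)=0$ is positive on $(0,\infty)$ and satisfies $$f^*(r)\sim K^* r^{-\mu}\qquad\text{as } r\to\infty .$$
   Context: Constants: $\alpha=\frac{p-q}{p-2q}>0$, $\beta=\frac{q-p+1}{p-2q}>0$, $\mu=\frac{p-q}{q-p+1}=\frac{\alpha}{\beta}$, and (for $N=1$) $K^*=\frac1\mu\left[(p-1)(\mu+1)\right]^{1/(q-p+1)}$. A solution of the differential equation with $f(0)=a$, $f'(0)=0$ is understood as a function $f\in C^1$ with $|f'|^{p-2}f'\in C^1$; equivalently, with $F:=-|f'|^{p-2}f'$, the pair $(f,F)$ is the unique maximal $C^1$ solution of $f'=-|F|^{(2-p)/(p-1)}F$, $F'=\alpha f-\beta r|F|^{(2-p)/(p-1)}F-|F|^{q/(p-1)}$, $f(0)=a$, $F(0)=0$. The notation $g_1(r)\sim g_2(r)$ as $r\to\infty$ means $g_1(r)/g_2(r)\to1$. *)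

theory Defs
  imports "HOL-Analysis.Analysis" "HOL-Library.Landau_Symbols"
begin

definition alpha :: "real \<Rightarrow> real \<Rightarrow> real"
  where "alpha p q = (p - q) / (p - 2 * q)"

definition beta :: "real \<Rightarrow> real \<Rightarrow> real"
  where "beta p q = (q - p + 1) / (p - 2 * q)"

definition mu :: "real \<Rightarrow> real \<Rightarrow> real"
  where "mu p q = (p - q) / (q - p + 1)"

definition K_star :: "real \<Rightarrow> real \<Rightarrow> real"
  where "K_star p q = (1 / mu p q) * ((p - 1) * (mu p q + 1)) powr (1 / (q - p + 1))"

text \<open>The flux \<open>|s|\<^sup>p\<^sup>-\<^sup>2s\<close>. As \<open>0 powr x = 0\<close>, it vanishes at \<open>s = 0\<close>, which for
  \<open>p > 1\<close> is the continuous extension.\<close>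

definition flux :: "real \<Rightarrow> real \<Rightarrow> real"
  where "flux p s = \<bar>s\<bar> powr (p - 2) * s"

text \<open>Global solutions on \<open>[0,\<infinity>)\<close> of the initial value problem with \<open>f(0) = a\<close>, \<open>f'(0) = 0\<close>:
  \<open>f\<close> and the flux of \<open>f'\<close> are continuously differentiable on \<open>[0,\<infinity>)\<close> (one-sided at \<open>0\<close>).
  Here \<open>f1\<close> is \<open>f'\<close> and \<open>d\<close> is the derivative of the flux; both are determined by \<open>f\<close> on
  \<open>[0,\<infinity>)\<close>. Values of \<open>f\<close> at negative arguments are irrelevant.
  A maximal solution that is positive on \<open>(0,\<infinity>)\<close> is in particular defined there, so it is such a
  global solution.\<close>

definition global_solution :: "real \<Rightarrow> real \<Rightarrow> real \<Rightarrow> (real \<Rightarrow> real) \<Rightarrow> bool"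
  where "global_solution p q a f \<longleftrightarrow>
    (\<exists>f1 d.
      (\<forall>r\<ge>0. (f has_real_derivative f1 r) (at r within {0..})) \<and>
      continuous_on {0..} f1 \<and>
      (\<forall>r\<ge>0. ((\<lambda>s. flux p (f1 s)) has_real_derivative d r) (at r within {0..})) \<and>
      continuous_on {0..} d \<and>
      (\<forall>r>0. d r + alpha p q * f r + beta p q * r * f1 r - \<bar>f1 r\<bar> powr q = 0) \<and>
      f 0 = a \<and> f1 0 = 0)"

text \<open>The rest of this theory proves that a global solution is determined by \<open>a\<close>,
  so that one may speak of \<^emph>\<open>the\<close> solution.\<close>

lemma powr_lipschitz_nonneg:
  fixes x y M m :: real
  assumes m: "m > 1" and xy: "0 \<le> x" "x \<le> y" "y \<le> M"
  shows "y powr m - x powr m \<le> m * M powr (m - 1) * (y - x)"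
proof (cases "x = y")
  case False
  then have lt: "x < y" using xy by simp
  have "continuous_on {x..y} (\<lambda>z. z powr m)"
    using m xy by (intro continuous_on_powr') (auto intro!: continuous_intros)
  moreover have "(\<lambda>z. z powr m) differentiable (at z)" if "x < z" "z < y" for z
    using has_real_derivative_powr[of z m] that xy by (auto simp: real_differentiable_def)
  ultimately obtain l z where z: "x < z" "z < y" "DERIV (\<lambda>z. z powr m) z :> l"
    "y powr m - x powr m = (y - x) * l"
    using MVT[OF lt] by blast
  have "l = m * z powr (m - 1)"
    using z xy has_real_derivative_powr[of z m] DERIV_unique by fastforce
  moreover have "z powr (m - 1) \<le> M powr (m - 1)"
    using z xy m by (intro powr_mono2) auto
  ultimately have "l \<le> m * M powr (m - 1)" using m by simp
  then show ?thesis using z(4) lt by (simp add: mult.commute mult_left_mono)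
qed simp

lemma abs_powr_lipschitz:
  fixes x y M m :: real
  assumes m: "m > 1" and xy: "\<bar>x\<bar> \<le> M" "\<bar>y\<bar> \<le> M"
  shows "\<bar>\<bar>x\<bar> powr m - \<bar>y\<bar> powr m\<bar> \<le> m * M powr (m - 1) * \<bar>x - y\<bar>"
proof -
  have le: "\<bar>\<bar>x\<bar> powr m - \<bar>y\<bar> powr m\<bar> \<le> m * M powr (m - 1) * \<bar>\<bar>x\<bar> - \<bar>y\<bar>\<bar>"
  proof (cases "\<bar>x\<bar> \<le> \<bar>y\<bar>")
    case True
    then show ?thesis
      using powr_lipschitz_nonneg[OF m _ True xy(2)] powr_mono2[of m "\<bar>x\<bar>" "\<bar>y\<bar>"] m by simp
  next
    case False
    then show ?thesis
      using powr_lipschitz_nonneg[OF m _ _ xy(1), of "\<bar>y\<bar>"] powr_mono2[of m "\<bar>y\<bar>" "\<bar>x\<bar>"] m by simp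
  qed
  also have "\<dots> \<le> m * M powr (m - 1) * \<bar>x - y\<bar>"
    using m by (intro mult_left_mono) auto
  finally show ?thesis .
qed

lemma signed_powr_lipschitz:
  fixes x y M k :: real
  assumes k: "k > 0" and xy: "\<bar>x\<bar> \<le> M" "\<bar>y\<bar> \<le> M"
  shows "\<bar>\<bar>x\<bar> powr k * x - \<bar>y\<bar> powr k * y\<bar> \<le> (k + 1) * M powr k * \<bar>x - y\<bar>"
proof (cases "x * y \<ge> 0")
  case True
  have e: "\<bar>z\<bar> powr k * \<bar>z\<bar> = \<bar>z\<bar> powr (k + 1)" for z :: real
    by (cases "z = 0") (auto simp: powr_add)
  have "\<bar>\<bar>x\<bar> powr k * x - \<bar>y\<bar> powr k * y\<bar> = \<bar>\<bar>x\<bar> powr (k + 1) - \<bar>y\<bar> powr (k + 1)\<bar>"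
  proof (cases "x \<ge> 0 \<and> y \<ge> 0")
    case False
    then have "\<bar>x\<bar> = - x" "\<bar>y\<bar> = - y" using True by (auto simp: zero_le_mult_iff)
    then have "\<bar>x\<bar> powr k * x - \<bar>y\<bar> powr k * y = - (\<bar>x\<bar> powr (k + 1) - \<bar>y\<bar> powr (k + 1))"
      using e[of x] e[of y] by simp
    then show ?thesis by linarith
  qed (use e[of x] e[of y] in simp)
  then show ?thesis using abs_powr_lipschitz[of "k + 1" x M y] k xy by simp
next
  case False
  then have s: "\<bar>x - y\<bar> = \<bar>x\<bar> + \<bar>y\<bar>"
    by (auto simp: not_le mult_less_0_iff abs_if)
  have "\<bar>\<bar>x\<bar> powr k * x - \<bar>y\<bar> powr k * y\<bar> \<le> \<bar>x\<bar> powr k * \<bar>x\<bar> + \<bar>y\<bar> powr k * \<bar>y\<bar>"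
    using abs_triangle_ineq4[of "\<bar>x\<bar> powr k * x" "\<bar>y\<bar> powr k * y"] by (simp add: abs_mult)
  also have "\<dots> \<le> M powr k * \<bar>x\<bar> + M powr k * \<bar>y\<bar>"
    using k xy by (intro add_mono mult_right_mono powr_mono2) auto
  also have "\<dots> = 1 * (M powr k * \<bar>x - y\<bar>)" by (simp add: s algebra_simps)
  also have "\<dots> \<le> (k + 1) * (M powr k * \<bar>x - y\<bar>)"
    using k by (intro mult_right_mono) auto
  finally show ?thesis by (simp add: mult.assoc)
qed

lemma flux_inverse:
  assumes "1 < p"
  shows "\<bar>flux p s\<bar> powr ((2 - p) / (p - 1)) * flux p s = s"
    and "\<bar>flux p s\<bar> powr (q / (p - 1)) = \<bar>s\<bar> powr q"
proof -
  have "\<bar>flux p s\<bar> = \<bar>s\<bar> powr (p - 1)"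
    using powr_add[of "\<bar>s\<bar>" "p - 2" 1] by (cases "s = 0") (auto simp: flux_def abs_mult)
  then have *: "\<bar>flux p s\<bar> powr t = \<bar>s\<bar> powr ((p - 1) * t)" for t
    by (simp add: powr_powr)
  show "\<bar>flux p s\<bar> powr (q / (p - 1)) = \<bar>s\<bar> powr q"
    unfolding * using assms by simp
  have "\<bar>s\<bar> powr (2 - p) * (\<bar>s\<bar> powr (p - 2) * s) = s"
    using powr_add[of "\<bar>s\<bar>" "2 - p" "p - 2"] by (cases "s = 0") (auto simp: mult.assoc[symmetric])
  then show "\<bar>flux p s\<bar> powr ((2 - p) / (p - 1)) * flux p s = s"
    unfolding * using assms by (simp add: flux_def)
qed

lemma gronwall_zero:
  fixes u u' :: "real \<Rightarrow> real"
  assumes R: "0 \<le> R" and cont: "continuous_on {0..R} u"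
    and der: "\<And>r. 0 < r \<Longrightarrow> r < R \<Longrightarrow> (u has_real_derivative u' r) (at r)"
    and le: "\<And>r. 0 < r \<Longrightarrow> r < R \<Longrightarrow> u' r \<le> C * u r"
    and u0: "u 0 = 0"
  shows "u R \<le> 0"
proof -
  have "u R * exp (- C * R) \<le> u 0 * exp (- C * 0)"
  proof (rule DERIV_nonpos_imp_decreasing_open[OF R, of "\<lambda>r. u r * exp (- C * r)"])
    fix r assume r: "0 < r" "r < R"
    have "((\<lambda>r. u r * exp (- C * r)) has_real_derivative (u' r - C * u r) * exp (- C * r)) (at r)"
      by (rule derivative_eq_intros der[OF r] refl | simp add: algebra_simps)+
    moreover have "(u' r - C * u r) * exp (- C * r) \<le> 0"
      using le[OF r] by (simp add: mult_nonpos_nonneg)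
    ultimately show "\<exists>y. ((\<lambda>r. u r * exp (- C * r)) has_real_derivative y) (at r) \<and> y \<le> 0"
      by blast
  qed (intro continuous_intros cont)
  then show ?thesis using u0 by (simp add: mult_le_0_iff)
qed

theorem global_solution_unique:
  assumes p: "1 < p" "p < 2" and q: "p - 1 < q"
    and f: "global_solution p q a f" and g: "global_solution p q a g"
    and "0 \<le> R"
  shows "f R = g R"
proof -
  obtain f1 d where f1: "\<And>r. 0 \<le> r \<Longrightarrow> (f has_real_derivative f1 r) (at r within {0..})"
    and d: "\<And>r. 0 \<le> r \<Longrightarrow> ((\<lambda>s. flux p (f1 s)) has_real_derivative d r) (at r within {0..})"
    and odef: "\<And>r. 0 < r \<Longrightarrow> d r + alpha p q * f r + beta p q * r * f1 r - \<bar>f1 r\<bar> powr q = 0"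
    and f0: "f 0 = a" "f1 0 = 0"
    using f unfolding global_solution_def by auto
  obtain g1 e where g1: "\<And>r. 0 \<le> r \<Longrightarrow> (g has_real_derivative g1 r) (at r within {0..})"
    and e: "\<And>r. 0 \<le> r \<Longrightarrow> ((\<lambda>s. flux p (g1 s)) has_real_derivative e r) (at r within {0..})"
    and odeg: "\<And>r. 0 < r \<Longrightarrow> e r + alpha p q * g r + beta p q * r * g1 r - \<bar>g1 r\<bar> powr q = 0"
    and g0: "g 0 = a" "g1 0 = 0"
    using g unfolding global_solution_def by auto
  define P where "P = (\<lambda>s. flux p (f1 s))"
  define Q where "Q = (\<lambda>s. flux p (g1 s))"
  define k where "k = (2 - p) / (p - 1)"
  define m where "m = q / (p - 1)"
  have k: "k > 0" and m: "m > 1" using p q by (auto simp: k_def m_def)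
  have cont: "continuous_on {0..R} h"
    if "\<And>r. 0 \<le> r \<Longrightarrow> (h has_real_derivative h' r) (at r within {0..})" for h h' :: "real \<Rightarrow> real"
  proof (rule continuous_on_subset[of "{0..}"])
    show "continuous_on {0..} h"
      using that by (intro DERIV_continuous_on[of _ _ h']) auto
  qed auto
  have cf: "continuous_on {0..R} f" and cg: "continuous_on {0..R} g"
    and cP: "continuous_on {0..R} P" and cQ: "continuous_on {0..R} Q"
    using cont[OF f1] cont[OF g1] cont[OF d] cont[OF e] by (auto simp: P_def Q_def)
  have "bounded (P ` {0..R} \<union> Q ` {0..R})"
    using cP cQ by (simp add: compact_imp_bounded compact_continuous_image)
  then obtain M where M: "\<And>x. x \<in> P ` {0..R} \<union> Q ` {0..R} \<Longrightarrow> \<bar>x\<bar> \<le> M"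
    by (auto simp: bounded_iff)
  define L1 where "L1 = (k + 1) * M powr k"
  define L2 where "L2 = m * M powr (m - 1)"
  have L: "L1 \<ge> 0" "L2 \<ge> 0" using k m by (auto simp: L1_def L2_def)
  define B where "B = L1 + \<bar>alpha p q\<bar>"
  define C where "C = B + 2 * (\<bar>beta p q\<bar> * R * L1 + L2)"
  define u where "u = (\<lambda>r. (f r - g r)\<^sup>2 + (P r - Q r)\<^sup>2)"
  define u' where "u' = (\<lambda>r. 2 * (f r - g r) * (f1 r - g1 r) + 2 * (P r - Q r) * (d r - e r))"
  have "u R \<le> 0"
  proof (rule gronwall_zero[OF \<open>0 \<le> R\<close>, of u u' C])
    show "continuous_on {0..R} u" unfolding u_def by (intro continuous_intros cf cg cP cQ)
    show "u 0 = 0" by (simp add: u_def P_def Q_def f0 g0)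
    fix r assume r: "0 < r" "r < R"
    have at: "at r within {0..} = at r" using r by (intro at_within_interior) simp
    note D = f1[of r] g1[of r] d[of r, folded P_def] e[of r, folded Q_def]
    show "(u has_real_derivative u' r) (at r)"
      unfolding u_def u'_def using r
      by (auto intro!: derivative_eq_intros D[unfolded at] simp: algebra_simps)
    have MP: "\<bar>P r\<bar> \<le> M" "\<bar>Q r\<bar> \<le> M" using M r by auto
    have fg: "\<bar>f1 r - g1 r\<bar> \<le> L1 * \<bar>P r - Q r\<bar>"
      using signed_powr_lipschitz[OF k MP] flux_inverse(1)[OF p(1), of "f1 r"]
        flux_inverse(1)[OF p(1), of "g1 r"] by (simp add: L1_def P_def Q_def k_def)
    have fgq: "\<bar>\<bar>f1 r\<bar> powr q - \<bar>g1 r\<bar> powr q\<bar> \<le> L2 * \<bar>P r - Q r\<bar>"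
      using abs_powr_lipschitz[OF m MP] flux_inverse(2)[OF p(1), of "f1 r" q]
        flux_inverse(2)[OF p(1), of "g1 r" q] by (simp add: L2_def P_def Q_def m_def)
    have "d r - e r = - (alpha p q * (f r - g r)) - beta p q * r * (f1 r - g1 r)
        + (\<bar>f1 r\<bar> powr q - \<bar>g1 r\<bar> powr q)"
      using odef[OF r(1)] odeg[OF r(1)] by (simp add: algebra_simps)
    then have "\<bar>d r - e r\<bar> \<le> \<bar>alpha p q * (f r - g r)\<bar> + \<bar>beta p q * r * (f1 r - g1 r)\<bar>
        + \<bar>\<bar>f1 r\<bar> powr q - \<bar>g1 r\<bar> powr q\<bar>"
      by linarith
    also have "\<bar>beta p q * r * (f1 r - g1 r)\<bar> \<le> \<bar>beta p q\<bar> * R * (L1 * \<bar>P r - Q r\<bar>)"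
      unfolding abs_mult using r fg by (intro mult_mono) auto
    finally have de: "\<bar>d r - e r\<bar> \<le> \<bar>alpha p q\<bar> * \<bar>f r - g r\<bar>
        + (\<bar>beta p q\<bar> * R * L1 + L2) * \<bar>P r - Q r\<bar>"
      using fgq unfolding abs_mult distrib_right by (simp add: mult.assoc)
    let ?x = "\<bar>f r - g r\<bar>" and ?y = "\<bar>P r - Q r\<bar>"
    have "u' r \<le> \<bar>2 * (f r - g r) * (f1 r - g1 r)\<bar> + \<bar>2 * (P r - Q r) * (d r - e r)\<bar>"
      unfolding u'_def by linarith
    also have "\<dots> = 2 * ?x * \<bar>f1 r - g1 r\<bar> + 2 * ?y * \<bar>d r - e r\<bar>"
      unfolding abs_mult by simp
    also have "\<dots> \<le> 2 * ?x * (L1 * ?y)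
        + 2 * ?y * (\<bar>alpha p q\<bar> * ?x + (\<bar>beta p q\<bar> * R * L1 + L2) * ?y)"
      using fg de by (intro add_mono mult_left_mono) auto
    also have "\<dots> = B * (2 * ?x * ?y) + 2 * (\<bar>beta p q\<bar> * R * L1 + L2) * ?y\<^sup>2"
      by (simp add: B_def algebra_simps power2_eq_square)
    also have "\<dots> \<le> B * (?x\<^sup>2 + ?y\<^sup>2) + 2 * (\<bar>beta p q\<bar> * R * L1 + L2) * (?x\<^sup>2 + ?y\<^sup>2)"
      using L \<open>0 \<le> R\<close> sum_squares_bound[of ?x ?y]
      by (intro add_mono mult_left_mono) (auto simp: B_def)
    also have "\<dots> = C * u r" by (simp add: C_def u_def algebra_simps)
    finally show "u' r \<le> C * u r" .
  qed
  then have "(f R - g R)\<^sup>2 \<le> 0"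
    using zero_le_power2[of "P R - Q R"] unfolding u_def by linarith
  then show ?thesis by simp
qed

end

theory Submission
  imports Defs
begin

text \<open>With \<open>F\<close> the negative flux and \<open>g = - f'\<close>, the equation reads \<open>f' = - g\<close>,
  \<open>F' = (\<alpha> f - \<beta> r g) - g\<^sup>q\<close>. The curve \<open>Y = r\<^sup>\<mu> f\<close> has \<open>Y'\<close> of the sign of the drift
  \<open>\<alpha> f - \<beta> r g\<close>, and at a critical point \<open>Y\<close> has a minimum if it is above \<open>K_star\<close> and a maximum if it
  is below. Hence the starting values for which the drift becomes negative (all large ones, by
  integrating the equation for \<open>F - \<beta> r f\<close>) and those for which \<open>Y\<close> exceeds \<open>K_star\<close> (all small ones)
  form two disjoint open sets. A starting value in neither set has \<open>Y\<close> and \<open>r\<^sup>\<mu>\<^sup>+\<^sup>1 g\<close> monotone and bounded,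
  which forces \<open>Y \<longlonglongrightarrow> K_star\<close>; conversely every solution with this limit arises so.

  For uniqueness, \<open>l\<^sup>\<mu> f(l r)\<close> with \<open>l > 1\<close> solves the equation with a factor \<open>k < 1\<close> in front of
  the drift, and \<open>l\<close> can be chosen such that it starts where the solution with the larger starting
  value does. Viewed as functions of the common height, the two fluxes are then strictly
  ordered, and their gap satisfies a linear differential inequality with integrable coefficient, so it
  stays away from \<open>0\<close>, although both fluxes tend to \<open>0\<close>.\<close>

section \<open>Calculus on the half-line\<close>

lemma integral_has_vector_derivative_Ici:
  fixes h :: "real \<Rightarrow> 'a::banach"
  assumes "continuous_on {0..} h" and "0 \<le> t"
  shows "((\<lambda>u. integral {0..u} h) has_vector_derivative h t) (at t within {0..})"
proof -
  have "at t within {0..t + 1} = at t within {0..}"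
    by (rule at_within_nhd[of _ "{..<t + 1}"]) auto
  moreover have "continuous_on {0..t + 1} h"
    by (rule continuous_on_subset[OF assms(1)]) auto
  ultimately show ?thesis
    using integral_has_vector_derivative[of 0 "t + 1" h t] assms(2) by simp
qed

text \<open>Banach's fixed point theorem in the sup norm weighted by \<open>exp (- 2 \<integral>L)\<close>, in which the
  Picard map contracts by the factor \<open>1/2\<close> on the whole half-line.\<close>

theorem picard_lindelof_Ici:
  fixes V :: "real \<Rightarrow> 'a::banach \<Rightarrow> 'a"
  assumes V: "continuous_on ({0..} \<times> UNIV) (\<lambda>w. V (fst w) (snd w))"
    and L: "continuous_on {0..} L"
    and lip: "\<And>t x y. 0 \<le> t \<Longrightarrow> norm (V t x - V t y) \<le> L t * norm (x - y)"
    and bd: "\<And>t. 0 \<le> t \<Longrightarrow> norm (V t x0) \<le> L t"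
  obtains u where "u 0 = x0" and
    "\<And>t. 0 \<le> t \<Longrightarrow> (u has_vector_derivative V t (u t)) (at t within {0..})"
proof -
  have L0: "0 \<le> L t" if "0 \<le> t" for t
    using bd[OF that] norm_ge_zero order_trans by blast
  \<comment> \<open>The weight satisfies \<open>W' = 2 * L * W\<close>, so the integral of
    \<open>L * W\<close> is at most half of \<open>W\<close>: the source of the contraction factor
    \<open>1/2\<close>.\<close>
  define W where "W = (\<lambda>t. exp (2 * integral {0..t} L))"
  have dW: "(W has_real_derivative 2 * L t * W t) (at t within {0..})" if "0 \<le> t" for t
  proof -
    have "((\<lambda>t. integral {0..t} L) has_real_derivative L t) (at t within {0..})"
      unfolding has_real_derivative_iff_has_vector_derivative
      by (rule integral_has_vector_derivative_Ici[OF L that])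
    from DERIV_chain2[OF DERIV_exp DERIV_cmult[OF this, of 2]] show ?thesis
      by (simp add: W_def mult_ac)
  qed
  then have cW: "continuous_on {0..} W"
    by (intro DERIV_continuous_on[of _ _ "\<lambda>t. 2 * L t * W t"]) auto
  have W1: "1 \<le> W t" if "0 \<le> t" for t
  proof -
    have "L integrable_on {0..t}"
      by (intro integrable_continuous_real continuous_on_subset[OF L]) auto
    then have "0 \<le> integral {0..t} L"
      by (rule Henstock_Kurzweil_Integration.integral_nonneg) (simp add: L0)
    then show ?thesis by (simp add: W_def)
  qed
  have est: "norm (integral {0..t} h) \<le> C / 2 * W t"
    if h: "continuous_on {0..} h" "\<And>s. 0 \<le> s \<Longrightarrow> norm (h s) \<le> C * (L s * W s)"
      and C: "0 \<le> C" and t: "0 \<le> t" for h :: "real \<Rightarrow> 'a" and C t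
  proof -
    have I: "((\<lambda>s. C * (L s * W s)) has_integral (C / 2 * W t - C / 2 * W 0)) {0..t}"
    proof (rule fundamental_theorem_of_calculus[OF t])
      fix x assume x: "x \<in> {0..t}"
      have "((\<lambda>s. C / 2 * W s) has_real_derivative C * (L x * W x)) (at x within {0..t})"
        by (rule DERIV_subset[of _ _ _ "{0..}"])
           (use x in \<open>auto intro!: derivative_eq_intros dW\<close>)
      then show "((\<lambda>s. C / 2 * W s) has_vector_derivative C * (L x * W x)) (at x within {0..t})"
        by (simp add: has_real_derivative_iff_has_vector_derivative)
    qed
    have "h integrable_on {0..t}"
      by (intro integrable_continuous_real continuous_on_subset[OF h(1)]) auto
    then have "norm (integral {0..t} h) \<le> integral {0..t} (\<lambda>s. C * (L s * W s))"
      by (rule Henstock_Kurzweil_Integration.integral_norm_bound_integral)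
         (use I h(2) has_integral_integrable in auto)
    also have "\<dots> = C / 2 * W t - C / 2 * W 0"
      using I by (rule integral_unique)
    finally have "norm (integral {0..t} h) \<le> C / 2 * W t - C / 2 * W 0" .
    moreover have "0 \<le> C / 2 * W 0" using C W1[of 0] by simp
    ultimately show ?thesis by linarith
  qed
  \<comment> \<open>The solution is sought as \<open>x0 + W * w\<close> with \<open>w\<close>
    bounded; \<open>N w\<close> is the vector field along it, so \<open>W * w\<close> has to be the
    integral of \<open>N w\<close>.\<close>
  define N where "N = (\<lambda>w t. V t (x0 + W t *\<^sub>R apply_bcontfun w t))"
  have cN: "continuous_on {0..} (N w)" for w
  proof -
    have "continuous_on {0..} ((\<lambda>w. V (fst w) (snd w)) \<circ> (\<lambda>t. (t, x0 + W t *\<^sub>R apply_bcontfun w t)))"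
      by (intro continuous_on_compose continuous_intros cW continuous_on_subset[OF V]) auto
    then show ?thesis by (simp add: N_def o_def)
  qed
  \<comment> \<open>Bounded continuous functions live on the whole line, hence the constant
    extension to negative times by \<open>max 0 t\<close>.\<close>
  define T where "T = (\<lambda>w t. inverse (W (max 0 t)) *\<^sub>R integral {0..max 0 t} (N w))"
  have Tb: "T w \<in> bcontfun" for w
  proof (rule bcontfun_normI[of _ "(1 + norm w) / 2"])
    have "continuous_on {0..} (\<lambda>t. integral {0..t} (N w))"
      using integral_has_vector_derivative_Ici[OF cN]
      by (intro continuous_on_vector_derivative) auto
    then have "continuous_on {0..} (\<lambda>t. inverse (W t) *\<^sub>R integral {0..t} (N w))"
      by (intro continuous_intros cW) (auto simp: W_def)
    then show "continuous_on UNIV (T w)" unfolding T_def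
      by (rule continuous_on_compose2[of _ _ _ "\<lambda>t. max 0 t"]) (auto intro!: continuous_intros)
    fix t :: real
    let ?t = "max 0 t"
    have "norm (N w s) \<le> (1 + norm w) * (L s * W s)" if s: "0 \<le> s" for s
    proof -
      have "norm (N w s) \<le> norm (N w s - V s x0) + norm (V s x0)"
        by (metis norm_triangle_sub add.commute)
      also have "\<dots> \<le> L s * (W s * norm w) + L s * W s"
      proof (rule add_mono)
        have "norm (N w s - V s x0) \<le> L s * norm (W s *\<^sub>R apply_bcontfun w s)"
          using lip[OF s, of "x0 + W s *\<^sub>R apply_bcontfun w s" x0] by (simp add: N_def)
        also have "\<dots> \<le> L s * (W s * norm w)"
          using L0[OF s] W1[OF s] norm_bounded[of w s]
          by (auto intro!: mult_left_mono)
        finally show "norm (N w s - V s x0) \<le> L s * (W s * norm w)" .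
        show "norm (V s x0) \<le> L s * W s"
          using bd[OF s] mult_left_mono[OF W1[OF s] L0[OF s]] by simp
      qed
      finally show ?thesis by (simp add: algebra_simps)
    qed
    from est[OF cN this, of ?t] have "norm (integral {0..?t} (N w)) \<le> (1 + norm w) / 2 * W ?t"
      by simp
    then show "norm (T w t) \<le> (1 + norm w) / 2"
      using W1[of ?t] by (simp add: T_def field_simps)
  qed
  define \<Phi> where "\<Phi> = (\<lambda>w. Bcontfun (T w))"
  have \<Phi>: "apply_bcontfun (\<Phi> w) = T w" for w
    unfolding \<Phi>_def using Tb Bcontfun_inverse by blast
  have "dist (\<Phi> v) (\<Phi> w) \<le> 1 / 2 * dist v w" for v w
  proof (rule dist_bound)
    fix t :: real
    let ?t = "max 0 t"
    have "norm (integral {0..?t} (\<lambda>s. N v s - N w s)) \<le> dist v w / 2 * W ?t"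
    proof (rule est)
      fix s :: real assume s: "0 \<le> s"
      have "norm (N v s - N w s) \<le> L s * (W s * dist (apply_bcontfun v s) (apply_bcontfun w s))"
        using lip[OF s, of "x0 + W s *\<^sub>R apply_bcontfun v s" "x0 + W s *\<^sub>R apply_bcontfun w s"] W1[OF s]
        by (simp add: N_def dist_norm flip: scaleR_diff_right)
      also have "\<dots> \<le> L s * (W s * dist v w)"
        using L0[OF s] W1[OF s] dist_bounded[of v s w] by (intro mult_left_mono) auto
      finally show "norm (N v s - N w s) \<le> dist v w * (L s * W s)" by (simp add: mult_ac)
    qed (auto intro!: continuous_intros cN)
    moreover have "integral {0..?t} (\<lambda>s. N v s - N w s) = integral {0..?t} (N v) - integral {0..?t} (N w)"
      by (rule Henstock_Kurzweil_Integration.integral_diff;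
          intro integrable_continuous_real continuous_on_subset[OF cN]; force)
    ultimately have "norm (integral {0..?t} (N v) - integral {0..?t} (N w)) / W ?t \<le> 1 / 2 * dist v w"
      using W1[of ?t] by (simp add: field_simps)
    moreover have "dist (apply_bcontfun (\<Phi> v) t) (apply_bcontfun (\<Phi> w) t) =
        norm (integral {0..?t} (N v) - integral {0..?t} (N w)) / W ?t"
      using W1[of ?t] unfolding \<Phi> T_def dist_norm scaleR_diff_right[symmetric] norm_scaleR
      by (simp add: divide_inverse)
    ultimately show "dist (apply_bcontfun (\<Phi> v) t) (apply_bcontfun (\<Phi> w) t) \<le> 1 / 2 * dist v w"
      by simp
  qed
  then obtain w where w: "\<Phi> w = w"
    using banach_fix_type[of "1/2" \<Phi>] by auto
  define u where "u = (\<lambda>t. x0 + integral {0..t} (N w))"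
  have Nu: "N w t = V t (u t)" if "0 \<le> t" for t
  proof -
    have "W t *\<^sub>R apply_bcontfun w t = W t *\<^sub>R T w t" using w \<Phi> by metis
    also have "\<dots> = integral {0..t} (N w)" using that W1[OF that] by (simp add: T_def)
    finally show ?thesis by (simp add: N_def u_def)
  qed
  show ?thesis
  proof
    show "u 0 = x0" by (simp add: u_def)
    fix t :: real assume t: "0 \<le> t"
    show "(u has_vector_derivative V t (u t)) (at t within {0..})"
      using integral_has_vector_derivative_Ici[OF cN t, of w] Nu[OF t]
      unfolding u_def by (auto intro!: derivative_eq_intros)
  qed
qed

section \<open>Monotonicity and sign changes of differentiable functions\<close>

lemma at_within_Ici_pos: "at r within {0..} = at (r::real)" if "0 < r"
  using that by (intro at_within_interior) simp

lemma antimono_Ici: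
  fixes h :: "real \<Rightarrow> real"
  assumes der: "\<And>r. 0 \<le> r \<Longrightarrow> (h has_real_derivative h' r) (at r within {0..})"
    and le: "\<And>r. s < r \<Longrightarrow> r < t \<Longrightarrow> h' r \<le> 0" and st: "0 \<le> s" "s \<le> t"
  shows "h t \<le> h s"
proof (rule DERIV_nonpos_imp_decreasing_open[OF st(2)])
  show "\<exists>y. (h has_real_derivative y) (at x) \<and> y \<le> 0" if "s < x" "x < t" for x
    using der[of x] le[of x] that st(1) by (auto simp: at_within_Ici_pos)
  have "continuous_on {0..} h" by (intro DERIV_continuous_on[of _ _ h'] der) auto
  then show "continuous_on {s..t} h"
    by (rule continuous_on_subset) (use st in auto)
qed

lemma mono_Ici:
  fixes h :: "real \<Rightarrow> real"
  assumes der: "\<And>r. 0 \<le> r \<Longrightarrow> (h has_real_derivative h' r) (at r within {0..})"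
    and le: "\<And>r. s < r \<Longrightarrow> r < t \<Longrightarrow> 0 \<le> h' r" and st: "0 \<le> s" "s \<le> t"
  shows "h s \<le> h t"
proof -
  have "- h t \<le> - h s"
    by (rule antimono_Ici[of "\<lambda>r. - h r" "\<lambda>r. - h' r"]) (use assms in \<open>auto intro!: DERIV_minus\<close>)
  then show ?thesis by simp
qed

lemma mono_pos:
  fixes h :: "real \<Rightarrow> real"
  assumes der: "\<And>r. 0 < r \<Longrightarrow> (h has_real_derivative h' r) (at r)"
    and le: "\<And>r. s < r \<Longrightarrow> r < t \<Longrightarrow> 0 \<le> h' r" and st: "0 < s" "s \<le> t"
  shows "h s \<le> h t"
proof (rule DERIV_nonneg_imp_increasing_open[OF st(2)])
  show "\<exists>y. (h has_real_derivative y) (at x) \<and> 0 \<le> y" if "s < x" "x < t" for x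
    using der[of x] le[of x] that st(1) by auto
  show "continuous_on {s..t} h"
    using der st by (intro DERIV_continuous_on[of _ _ h'])
      (auto intro: has_field_derivative_at_within)
qed

text \<open>At a first zero the positive derivative would make \<open>D\<close> negative just
  before, where it is still positive. So \<open>step\<close> may assume positivity on all of
  \<open>[a, t)\<close>.\<close>

lemma pos_persists:
  fixes D :: "real \<Rightarrow> real"
  assumes cont: "continuous_on {a..b} D" and Da: "0 < D a"
    and step: "\<And>t. a < t \<Longrightarrow> t \<le> b \<Longrightarrow> D t = 0 \<Longrightarrow> (\<And>s. a \<le> s \<Longrightarrow> s < t \<Longrightarrow> 0 < D s) \<Longrightarrow>
      \<exists>d>0. (D has_real_derivative d) (at t)"
    and t: "a \<le> t" "t \<le> b"
  shows "0 < D t"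
proof (rule ccontr)
  assume "\<not> 0 < D t"
  define S where "S = {a..b} \<inter> D -` {..0}"
  have S: "t \<in> S" "S \<noteq> {}" "bdd_below S"
    using t \<open>\<not> 0 < D t\<close> by (auto simp: S_def bdd_below_def)
  have "closed S" unfolding S_def by (intro continuous_closed_preimage cont) auto
  then have IS: "Inf S \<in> S" using S closed_contains_Inf by blast
  have pos: "0 < D s" if "a \<le> s" "s < Inf S" for s
  proof (rule ccontr)
    assume "\<not> 0 < D s"
    then have "s \<in> S" using that IS by (auto simp: S_def)
    then show False using that cInf_lower[OF _ S(3)] by force
  qed
  have *: "a < Inf S" "Inf S \<le> b" using IS Da by (auto simp: S_def le_less)
  have "D (Inf S) = 0"
  proof (rule ccontr)
    assume "D (Inf S) \<noteq> 0"
    then have "D (Inf S) < 0" using IS by (auto simp: S_def)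
    moreover have "continuous_on {a..Inf S} D"
      by (rule continuous_on_subset[OF cont]) (use * in auto)
    ultimately obtain s where "a \<le> s" "s \<le> Inf S" "D s = 0"
      using IVT2'[of D "Inf S" 0 a] Da * by auto
    then show False using pos[of s] \<open>D (Inf S) < 0\<close> by (cases "s = Inf S") auto
  qed
  from step[OF * this pos] obtain d where "d > 0" "(D has_real_derivative d) (at (Inf S))" by blast
  from has_real_derivative_pos_inc_left[OF this(2,1)] obtain e where e: "e > 0"
    "\<And>h. 0 < h \<Longrightarrow> h < e \<Longrightarrow> D (Inf S - h) < D (Inf S)" by auto
  define h where "h = min (e / 2) (Inf S - a)"
  have "0 < h" "h < e" "a \<le> Inf S - h" using e(1) *(1) by (auto simp: h_def min_def)
  then show False using e(2)[of h] pos[of "Inf S - h"] \<open>D (Inf S) = 0\<close> by auto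
qed

text \<open>The start is itself a zero, where the positive derivative lifts \<open>F\<close> off;
  from then on \<open>pos_persists\<close> applies.\<close>

lemma pos_of_DERIV_pos_at_zeros:
  fixes F :: "real \<Rightarrow> real"
  assumes F: "\<And>r. 0 \<le> r \<Longrightarrow> (F has_real_derivative F' r) (at r within {0..})"
    and F0: "F 0 = 0" and t: "0 < t"
    and pos: "\<And>r. 0 \<le> r \<Longrightarrow> r \<le> t \<Longrightarrow> F r = 0 \<Longrightarrow> 0 < F' r"
  shows "0 < F t"
proof -
  obtain d where d: "d > 0" "\<And>h. 0 < h \<Longrightarrow> h < d \<Longrightarrow> 0 < F h"
    using has_real_derivative_pos_inc_right[OF F[of 0] pos[of 0]] F0 t by auto
  define h where "h = min (d / 2) t"
  have h: "0 < h" "h < d" "h \<le> t" using d t by (auto simp: h_def)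
  show ?thesis
  proof (rule pos_persists[of h t F])
    have "continuous_on {0..} F" by (intro DERIV_continuous_on[of _ _ F'] F) auto
    then show "continuous_on {h..t} F" by (rule continuous_on_subset) (use h in auto)
    show "\<exists>d>0. (F has_real_derivative d) (at s)" if "h < s" "s \<le> t" "F s = 0" for s
      using F[of s] pos[of s] that h by (auto simp: at_within_Ici_pos)
  qed (use d h in auto)
qed

lemma last_zero:
  fixes D :: "real \<Rightarrow> real"
  assumes cont: "continuous_on {a..b} D" and D: "0 < D a" "D b < 0" and ab: "a \<le> b"
  obtains t where "a < t" "t < b" "D t = 0" "\<And>s. t < s \<Longrightarrow> s \<le> b \<Longrightarrow> D s < 0"
proof -
  define S where "S = {a..b} \<inter> D -` {0..}"
  have S: "a \<in> S" "S \<noteq> {}" "bdd_above S"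
    using D ab by (auto simp: S_def bdd_above_def)
  have "closed S" unfolding S_def by (intro continuous_closed_preimage cont) auto
  then have SS: "Sup S \<in> S" using S closed_contains_Sup by blast
  have neg: "D s < 0" if "Sup S < s" "s \<le> b" for s
  proof (rule ccontr)
    assume "\<not> D s < 0"
    then have "s \<in> S" using that SS by (auto simp: S_def)
    then show False using that cSup_upper[OF _ S(3)] by force
  qed
  have *: "a \<le> Sup S" "Sup S < b" using SS D by (auto simp: S_def le_less)
  have "D (Sup S) = 0"
  proof (rule ccontr)
    assume "D (Sup S) \<noteq> 0"
    then have "D (Sup S) > 0" using SS by (auto simp: S_def)
    moreover have "continuous_on {Sup S..b} D"
      by (rule continuous_on_subset[OF cont]) (use * in auto)
    ultimately obtain s where "Sup S \<le> s" "s \<le> b" "D s = 0"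
      using IVT2'[of D b 0 "Sup S"] D * by auto
    then show False using neg[of s] \<open>D (Sup S) > 0\<close> by (cases "s = Sup S") auto
  qed
  then show thesis using that[of "Sup S"] * neg D by (cases "a = Sup S") auto
qed

text \<open>At \<open>0\<close> the difference quotient is at most
  \<open>\<bar>h\<bar> powr (k - 1)\<close>, which tends to \<open>0\<close> as
  \<open>k > 1\<close>. Powers of the truncated flux can thus be differentiated also where the flux
  vanishes.\<close>

lemma DERIV_max0_powr:
  fixes x k :: real
  assumes k: "1 < k"
  shows "((\<lambda>x. max 0 x powr k) has_real_derivative k * max 0 x powr (k - 1)) (at x)"
proof -
  consider "x > 0" | "x < 0" | "x = 0" by linarith
  then show ?thesis
  proof cases
    case 1
    have "((\<lambda>x. x powr k) has_real_derivative k * max 0 x powr (k - 1)) (at x)"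
      using 1 has_real_derivative_powr[of x k] by (simp add: max_def)
    then show ?thesis
      by (rule has_field_derivative_transform_within_open[of _ _ _ "{0<..}"])
         (use 1 in \<open>auto simp: max_def\<close>)
  next
    case 2
    have "((\<lambda>x. 0) has_real_derivative 0) (at x)" by simp
    then have "((\<lambda>x. max 0 x powr k) has_real_derivative 0) (at x)"
      by (rule has_field_derivative_transform_within_open[of _ _ _ "{..<0}"])
         (use 2 in \<open>auto simp: max_def\<close>)
    then show ?thesis using 2 by (simp add: max_def)
  next
    case 3
    have "((\<lambda>h. (max 0 h powr k - 0) / h) \<longlongrightarrow> 0) (at 0)"
    proof (rule Lim_null_comparison)
      have "((\<lambda>h::real. \<bar>h\<bar> powr (k - 1)) \<longlongrightarrow> \<bar>0\<bar> powr (k - 1)) (at 0)"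
        using k by (intro tendsto_powr' tendsto_intros) auto
      then show "((\<lambda>h::real. \<bar>h\<bar> powr (k - 1)) \<longlongrightarrow> 0) (at 0)" by simp
      have "norm ((max 0 h powr k - 0) / h) \<le> \<bar>h\<bar> powr (k - 1)" for h :: real
        using powr_diff[of h k 1] by (auto simp: max_def)
      then show "\<forall>\<^sub>F h in at 0. norm ((max 0 h powr k - 0) / h) \<le> \<bar>h\<bar> powr (k - 1)" by simp
    qed
    then show ?thesis using 3 by (simp add: DERIV_def)
  qed
qed

lemma max0_powr_lipschitz:
  fixes x y M k :: real
  assumes "1 < k" "x \<le> M" "y \<le> M" "0 \<le> M"
  shows "\<bar>max 0 x powr k - max 0 y powr k\<bar> \<le> k * M powr (k - 1) * \<bar>x - y\<bar>"
proof -
  have "\<bar>max 0 x powr k - max 0 y powr k\<bar> \<le> k * M powr (k - 1) * \<bar>max 0 x - max 0 y\<bar>"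
    using abs_powr_lipschitz[of k "max 0 x" M "max 0 y"] assms by simp
  also have "\<dots> \<le> k * M powr (k - 1) * \<bar>x - y\<bar>"
    using assms by (intro mult_left_mono) (auto simp: max_def)
  finally show ?thesis .
qed

section \<open>The flow\<close>

text \<open>\<open>p < 2\<close> and \<open>p - 1 < q\<close> make \<open>1 / (p - 1)\<close> and
  \<open>q / (p - 1)\<close> greater than \<open>1\<close>, so the slope and its \<open>q\<close>-th
  power are continuously differentiable functions of the flux. The equation describes the profiles
  of self-similar solutions \<open>(T - t) powr \<alpha> * f (\<bar>x\<bar> * (T - t) powr
  \<beta>)\<close> of p-Laplace diffusion with gradient absorption, which become extinct at time
  \<open>T\<close>.\<close>

locale very_singular =
  fixes p q :: real
  assumes p1: "1 < p" and p2: "p < 2" and q1: "p - 1 < q" and q2: "q < p / 2"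
begin

abbreviation "\<alpha> \<equiv> alpha p q"
abbreviation "\<beta> \<equiv> beta p q"
abbreviation "\<mu> \<equiv> mu p q"

text \<open>Equals \<open>\<mu> * K\<close>, the value of \<open>- r powr (\<mu> + 1) * f'\<close>
  for \<open>f = K * r powr (- \<mu>)\<close>: for this slope diffusion balances absorption while
  the drift vanishes.\<close>

definition "slope_lim = ((p - 1) * (\<mu> + 1)) powr (\<mu> + 1)"

section \<open>Relations between the exponents\<close>

lemma alpha_pos: "0 < \<alpha>" and beta_pos: "0 < \<beta>"
  using p1 p2 q1 q2 by (auto simp: alpha_def beta_def)

lemma beta_less_alpha: "\<beta> < \<alpha>"
  unfolding alpha_def beta_def using p1 q2 by (intro divide_strict_right_mono) auto

lemma alpha_eq: "\<alpha> = \<beta> * \<mu>"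
  using p1 p2 q1 q2 by (auto simp: alpha_def beta_def mu_def)

lemma mu_gt1: "1 < \<mu>"
  using p1 p2 q1 q2 by (auto simp: mu_def field_simps)

lemma mu_pos: "0 < \<mu>" using mu_gt1 by simp

lemma mu1: "(\<mu> + 1) * (q - p + 1) = 1"
  using q1 by (simp add: mu_def field_simps)

lemma mu_q: "(p - 1) * (\<mu> + 1) + 1 = q * (\<mu> + 1)"
  using mu1 by (simp add: algebra_simps)

lemma q_lt1: "q < 1" and q_pos: "0 < q"
  using p1 p2 q1 q2 by auto

text \<open>The difference of the two sides is the power of the scale by which the drift changes
  relative to the other terms under rescaling, and also the decay exponent \<open>\<sigma>\<close>
  in the comparison of two critical solutions.\<close>

lemma q_mu_less: "q * (\<mu> + 1) < \<mu>"
proof -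
  have "\<mu> + 1 = 1 / (q - p + 1)" using mu1 q1 by (simp add: field_simps)
  then have "\<mu> - q * (\<mu> + 1) = (p - q) / (q - p + 1) - q / (q - p + 1)"
    by (simp add: mu_def)
  also have "\<dots> = (p - 2 * q) / (q - p + 1)" by (simp add: diff_divide_distrib[symmetric])
  also have "0 < \<dots>" using q1 q2 by simp
  finally show ?thesis by simp
qed

text \<open>With slopes of order \<open>a powr (2 / p)\<close> a solution stays near its start
  \<open>a\<close> over lengths of order \<open>a powr (1 - 2 / p)\<close>; by this inequality
  \<open>r powr \<mu> * f r\<close> is then unbounded as \<open>a\<close> tends to
  \<open>0\<close>.\<close>

lemma mu_p: "p < \<mu> * (2 - p)"
proof -
  have "\<mu> * (2 - p) - p = ((p - q) * (2 - p) - p * (q - p + 1)) / (q - p + 1)"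
    using q1 unfolding mu_def by (simp add: field_simps)
  also have "\<dots> = (p - 2 * q) / (q - p + 1)" by (simp add: algebra_simps)
  also have "0 < \<dots>" using q1 q2 by simp
  finally show ?thesis by simp
qed

lemma slope_lim_pos: "0 < slope_lim" using p1 mu_pos by (simp add: slope_lim_def)

lemma slope_lim_powr: "slope_lim powr (q - p + 1) = (p - 1) * (\<mu> + 1)"
  using mu1 p1 mu_pos by (simp add: slope_lim_def powr_powr)

lemma K_eq: "K_star p q = slope_lim / \<mu>"
proof -
  have "1 / (q - p + 1) = \<mu> + 1" using mu1 q1 by (simp add: field_simps)
  then show ?thesis by (simp add: K_star_def slope_lim_def)
qed

abbreviation "K \<equiv> K_star p q"

lemma K_pos: "0 < K" using slope_lim_pos mu_pos by (simp add: K_eq)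

text \<open>The inverse of the flux on positive values, so that \<open>gam F = - f'\<close> for
  nonincreasing \<open>f\<close>. The value \<open>0\<close> for negative arguments gives the system
  a meaning for every \<open>F\<close> and makes the first component of each solution
  nonincreasing.\<close>

definition gam :: "real \<Rightarrow> real" where "gam x = max 0 x powr (1 / (p - 1))"

lemma gam_nonneg [simp]: "0 \<le> gam x" by (simp add: gam_def)

lemma gam_pos: "0 < gam x \<longleftrightarrow> 0 < x"
  by (auto simp: gam_def max_def)

lemma gam_nonpos: "x \<le> 0 \<Longrightarrow> gam x = 0"
  by (simp add: gam_def max_def)

lemma gam_powr: "gam x powr s = max 0 x powr (s / (p - 1))"
  by (simp add: gam_def powr_powr)

lemma gam_powr_p1: "0 \<le> x \<Longrightarrow> gam x powr (p - 1) = x"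
  using p1 by (simp add: gam_powr max_def)

lemma gam_mono: "x \<le> y \<Longrightarrow> gam x \<le> gam y"
  unfolding gam_def using p1 by (intro powr_mono2) auto

lemma gam_less: "0 \<le> x \<Longrightarrow> x < y \<Longrightarrow> gam x < gam y"
  unfolding gam_def using p1 by (intro powr_less_mono2) auto

lemma gam_less_iff: "gam x < gam y \<Longrightarrow> x < y"
  using gam_mono[of y x] by linarith

lemma DERIV_gam_powr:
  assumes F: "(F has_real_derivative d) (at r within S)" and s: "p - 1 < s"
  shows "((\<lambda>r. gam (F r) powr s) has_real_derivative
    s / (p - 1) * gam (F r) powr (s + 1 - p) * d) (at r within S)"
proof -
  have "1 < s / (p - 1)" using p1 s by simp
  moreover have "s / (p - 1) - 1 = (s + 1 - p) / (p - 1)" using p1 by (simp add: field_simps)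
  ultimately show ?thesis
    using DERIV_chain2[OF DERIV_max0_powr[of "s / (p - 1)" "F r"] F] by (simp add: gam_powr)
qed

lemma DERIV_gam:
  assumes F: "(F has_real_derivative d) (at r within S)"
  shows "((\<lambda>r. gam (F r)) has_real_derivative gam (F r) powr (2 - p) / (p - 1) * d) (at r within S)"
  using DERIV_gam_powr[OF F, of 1] p2 by simp

lemma gam_lipschitz:
  assumes "p - 1 < s" "x \<le> M" "y \<le> M" "0 \<le> M"
  shows "\<bar>gam x powr s - gam y powr s\<bar> \<le> s / (p - 1) * M powr (s / (p - 1) - 1) * \<bar>x - y\<bar>"
  using max0_powr_lipschitz[of "s / (p - 1)" x M y] assms p1 by (simp add: gam_powr)

text \<open>\<open>F\<close> is the negative of the flux of \<open>f'\<close>. The factor \<open>k\<close> in front of the lower order terms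
  is what the rescaling \<open>f(r) \<mapsto> l\<^sup>\<mu> f(l r)\<close> produces.\<close>

definition sol :: "real \<Rightarrow> real \<Rightarrow> (real \<Rightarrow> real) \<Rightarrow> (real \<Rightarrow> real) \<Rightarrow> bool" where
  "sol k a f F \<longleftrightarrow> f 0 = a \<and> F 0 = 0 \<and>
    (\<forall>r\<ge>0. (f has_real_derivative - gam (F r)) (at r within {0..})) \<and>
    (\<forall>r\<ge>0. (F has_real_derivative k * (\<alpha> * f r - \<beta> * r * gam (F r)) - gam (F r) powr q)
      (at r within {0..}))"

section \<open>A priori bounds, continuous dependence and existence\<close>

lemma
  assumes "sol k a f F"
  shows sol_0: "f 0 = a" "F 0 = 0"
    and sol_f: "0 \<le> r \<Longrightarrow> (f has_real_derivative - gam (F r)) (at r within {0..})"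
    and sol_F: "0 \<le> r \<Longrightarrow> (F has_real_derivative
      k * (\<alpha> * f r - \<beta> * r * gam (F r)) - gam (F r) powr q) (at r within {0..})"
    and sol_f_at: "0 < r \<Longrightarrow> (f has_real_derivative - gam (F r)) (at r)"
    and sol_F_at: "0 < r \<Longrightarrow> (F has_real_derivative
      k * (\<alpha> * f r - \<beta> * r * gam (F r)) - gam (F r) powr q) (at r)"
proof -
  show "f 0 = a" "F 0 = 0"
    and f: "\<And>r. 0 \<le> r \<Longrightarrow> (f has_real_derivative - gam (F r)) (at r within {0..})"
    and F: "\<And>r. 0 \<le> r \<Longrightarrow> (F has_real_derivative
      k * (\<alpha> * f r - \<beta> * r * gam (F r)) - gam (F r) powr q) (at r within {0..})"
    using assms by (auto simp: sol_def)
  show "0 < r \<Longrightarrow> (f has_real_derivative - gam (F r)) (at r)"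
    "0 < r \<Longrightarrow> (F has_real_derivative
      k * (\<alpha> * f r - \<beta> * r * gam (F r)) - gam (F r) powr q) (at r)"
    using f[of r] F[of r] by (auto simp: at_within_Ici_pos)
qed

lemma sol_cont:
  assumes "sol k a f F"
  shows "continuous_on {0..} f" "continuous_on {0..} F" "continuous_on {0..} (\<lambda>r. gam (F r))"
proof -
  show "continuous_on {0..} f"
    using sol_f[OF assms] by (intro DERIV_continuous_on) auto
  show "continuous_on {0..} F"
    using sol_F[OF assms] by (intro DERIV_continuous_on) auto
  show "continuous_on {0..} (\<lambda>r. gam (F r))"
    using DERIV_gam[OF sol_F[OF assms]] by (intro DERIV_continuous_on) auto
qed

lemma sol_antimono: "sol k a f F \<Longrightarrow> 0 \<le> s \<Longrightarrow> s \<le> t \<Longrightarrow> f t \<le> f s"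
  using antimono_Ici[OF sol_f[of k a f F], of s t] by simp

lemma sol_le: "sol k a f F \<Longrightarrow> 0 \<le> t \<Longrightarrow> f t \<le> a"
  using sol_antimono[of k a f F 0 t] sol_0(1)[of k a f F] by simp

text \<open>All terms of \<open>F'\<close> other than \<open>k * \<alpha> * f\<close> are
  nonpositive, and \<open>f \<le> a\<close>. The bound confines \<open>F\<close> to a range where
  \<open>gam\<close> has a Lipschitz constant.\<close>

lemma F_le:
  assumes s: "sol k a f F" and k: "0 \<le> k" and t: "0 \<le> t"
  shows "F t \<le> k * \<alpha> * a * t"
proof -
  have "F t - k * \<alpha> * a * t \<le> F 0 - k * \<alpha> * a * 0"
  proof (rule antimono_Ici[OF _ _ _ t])
    show "((\<lambda>t. F t - k * \<alpha> * a * t) has_real_derivative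
        k * (\<alpha> * f r - \<beta> * r * gam (F r)) - gam (F r) powr q - k * \<alpha> * a) (at r within {0..})"
      if "0 \<le> r" for r
      by (rule derivative_eq_intros sol_F[OF s that] refl | simp)+
    fix r :: real assume r: "0 < r"
    have "k * (\<alpha> * f r - \<beta> * r * gam (F r)) \<le> k * (\<alpha> * a)"
      using sol_le[OF s, of r] r k alpha_pos beta_pos
      by (intro mult_left_mono) (auto intro: add_increasing2 simp: diff_le_eq)
    then show "k * (\<alpha> * f r - \<beta> * r * gam (F r)) - gam (F r) powr q - k * \<alpha> * a \<le> 0"
      using powr_ge_zero[of "gam (F r)" q] by (simp add: mult.assoc del: powr_ge_zero)
  qed simp
  then show ?thesis using sol_0[OF s] by simp
qed

text \<open>Gronwall's inequality for the squared distance. As \<open>F_le\<close> bounds both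
  fluxes on \<open>[0, R]\<close>, the Lipschitz constants of \<open>gam\<close> and of its
  \<open>q\<close>-th power are common to all starting values up to \<open>B\<close>.\<close>

lemma sol_continuous_dependence:
  assumes k: "0 < k" and B: "0 \<le> B" and R: "0 \<le> R"
  obtains C where "\<And>a b f F g G. 0 \<le> a \<Longrightarrow> a \<le> B \<Longrightarrow> 0 \<le> b \<Longrightarrow> b \<le> B \<Longrightarrow>
    sol k a f F \<Longrightarrow> sol k b g G \<Longrightarrow> (f R - g R)\<^sup>2 + (F R - G R)\<^sup>2 \<le> C * (a - b)\<^sup>2"
proof
  define M where "M = k * \<alpha> * B * R"
  define c1 where "c1 = 1 / (p - 1) * M powr (1 / (p - 1) - 1)"
  define c2 where "c2 = q / (p - 1) * M powr (q / (p - 1) - 1)"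
  define C where "C = c1 + k * \<alpha> + 2 * (k * \<beta> * R * c1 + c2)"
  have M: "0 \<le> M" using k B R alpha_pos by (simp add: M_def)
  have c: "0 \<le> c1" "0 \<le> c2" using p1 q_pos by (auto simp: c1_def c2_def)
  fix a b f F g G
  assume a: "0 \<le> a" "a \<le> B" and b: "0 \<le> b" "b \<le> B" and s: "sol k a f F" and t: "sol k b g G"
  define u where "u = (\<lambda>r. (f r - g r)\<^sup>2 + (F r - G r)\<^sup>2)"
  define P where "P = (\<lambda>r. gam (F r) - gam (G r))"
  define Q where "Q = (\<lambda>r. gam (F r) powr q - gam (G r) powr q)"
  define u' where "u' = (\<lambda>r. 2 * (f r - g r) * - P r +
    2 * (F r - G r) * (k * (\<alpha> * (f r - g r) - \<beta> * r * P r) - Q r))"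
  have du: "(u has_real_derivative u' r) (at r within {0..})" if r: "0 \<le> r" for r
    unfolding u_def u'_def P_def Q_def
    by (rule derivative_eq_intros sol_f[OF s r] sol_F[OF s r] sol_f[OF t r] sol_F[OF t r] refl
        | simp add: algebra_simps)+
  have cu: "continuous_on {0..} u" by (intro DERIV_continuous_on[of _ _ u'] du) auto
  have le: "u' r \<le> C * u r" if r: "0 < r" "r < R" for r
  proof -
    have M': "k * \<alpha> * x * r \<le> M" if "0 \<le> x" "x \<le> B" for x
      unfolding M_def using that k alpha_pos r B by (intro mult_mono mult_nonneg_nonneg) auto
    have FM: "F r \<le> M" "G r \<le> M"
      using F_le[OF s, of r] F_le[OF t, of r] M'[OF a] M'[OF b] k r by auto
    let ?x = "\<bar>f r - g r\<bar>" and ?y = "\<bar>F r - G r\<bar>"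
    have P: "\<bar>P r\<bar> \<le> c1 * ?y" and Q: "\<bar>Q r\<bar> \<le> c2 * ?y"
      using gam_lipschitz[of 1 "F r" M "G r"] gam_lipschitz[of q "F r" M "G r"] FM M q1 p2
      by (auto simp: P_def Q_def c1_def c2_def)
    have "u' r \<le> 2 * ?x * \<bar>P r\<bar> + 2 * ?y * (k * (\<alpha> * ?x + \<beta> * r * \<bar>P r\<bar>) + \<bar>Q r\<bar>)"
    proof -
      have "u' r \<le> \<bar>2 * (f r - g r) * - P r\<bar> +
          \<bar>2 * (F r - G r) * (k * (\<alpha> * (f r - g r) - \<beta> * r * P r) - Q r)\<bar>"
        unfolding u'_def by linarith
      also have "\<dots> \<le> 2 * ?x * \<bar>P r\<bar> + 2 * ?y * (k * (\<alpha> * ?x + \<beta> * r * \<bar>P r\<bar>) + \<bar>Q r\<bar>)"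
      proof -
        have "\<bar>k * (\<alpha> * (f r - g r) - \<beta> * r * P r) - Q r\<bar>
            \<le> k * \<bar>\<alpha> * (f r - g r) - \<beta> * r * P r\<bar> + \<bar>Q r\<bar>"
          using k abs_triangle_ineq4[of "k * (\<alpha> * (f r - g r) - \<beta> * r * P r)" "Q r"]
          by (simp add: abs_mult)
        also have "\<dots> \<le> k * (\<alpha> * ?x + \<beta> * r * \<bar>P r\<bar>) + \<bar>Q r\<bar>"
          using k alpha_pos beta_pos r abs_triangle_ineq4[of "\<alpha> * (f r - g r)" "\<beta> * r * P r"]
          by (simp add: abs_mult)
        finally show ?thesis
          unfolding abs_mult abs_minus_cancel abs_numeral
          by (intro add_mono mult_left_mono order_refl) auto
      qed
      finally show ?thesis .
    qed
    also have "\<dots> \<le> 2 * ?x * (c1 * ?y) + 2 * ?y * (k * (\<alpha> * ?x + \<beta> * R * (c1 * ?y)) + c2 * ?y)"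
      using P Q k alpha_pos beta_pos r R c
      by (intro add_mono mult_left_mono mult_mono order_refl) auto
    also have "\<dots> = (c1 + k * \<alpha>) * (2 * ?x * ?y) + 2 * (k * \<beta> * R * c1 + c2) * ?y\<^sup>2"
      by (simp add: algebra_simps power2_eq_square)
    also have "\<dots> \<le> (c1 + k * \<alpha>) * (?x\<^sup>2 + ?y\<^sup>2) + 2 * (k * \<beta> * R * c1 + c2) * (?x\<^sup>2 + ?y\<^sup>2)"
      using c k alpha_pos beta_pos R sum_squares_bound[of ?x ?y]
      by (intro add_mono mult_left_mono) auto
    also have "\<dots> = C * u r" by (simp add: C_def u_def algebra_simps)
    finally show ?thesis .
  qed
  let ?v = "\<lambda>r. u r - u 0 * exp (C * r)"
  have "?v R \<le> 0"
  proof (rule gronwall_zero[OF R, of ?v "\<lambda>r. u' r - u 0 * (C * exp (C * r))" C])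
    show "continuous_on {0..R} ?v"
      by (intro continuous_intros continuous_on_subset[OF cu]) auto
    fix r assume r: "0 < r" "r < R"
    show "(?v has_real_derivative u' r - u 0 * (C * exp (C * r))) (at r)"
      using du[of r] r by (auto simp: at_within_Ici_pos intro!: derivative_eq_intros)
    show "u' r - u 0 * (C * exp (C * r)) \<le> C * ?v r"
      using le[OF r] by (simp add: algebra_simps)
  qed simp
  then show "(f R - g R)\<^sup>2 + (F R - G R)\<^sup>2 \<le> exp (C * R) * (a - b)\<^sup>2"
    using sol_0[OF s] sol_0[OF t] by (simp add: u_def mult.commute)
qed

lemma continuous_on_gam: "continuous_on S h \<Longrightarrow> continuous_on S (\<lambda>x. gam (h x))"
  unfolding gam_def using p1 by (intro continuous_on_powr' continuous_intros) auto

text \<open>The flow is made globally Lipschitz by cutting \<open>F\<close> off at the a priori bound of \<open>F_le\<close>.\<close>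

lemma sol_exists:
  assumes k: "0 < k" and a: "0 < a"
  shows "\<exists>f F. sol k a f F"
proof -
  define M where "M = (\<lambda>t. k * \<alpha> * a * t)"
  define G where "G = (\<lambda>t (z::real \<times> real). gam (min (snd z) (M t)))"
  define V where "V = (\<lambda>t z. (- G t z, k * (\<alpha> * fst z - \<beta> * t * G t z) - G t z powr q))"
  define c where "c = (\<lambda>s t. s / (p - 1) * M t powr (s / (p - 1) - 1))"
  \<comment> \<open>The last summand is the norm of the field at the start; the others are Lipschitz
    constants of its two components.\<close>
  define L where "L = (\<lambda>t. c 1 t + (k * (\<alpha> + \<beta> * t * c 1 t) + c q t) + k * \<alpha> * a)"
  have M0: "0 \<le> M t" if "0 \<le> t" for t using that k a alpha_pos by (simp add: M_def)
  have cG: "continuous_on ({0..} \<times> UNIV) (\<lambda>w. G (fst w) (snd w))"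
    unfolding G_def M_def by (intro continuous_on_gam continuous_intros)
  have cGq: "continuous_on ({0..} \<times> UNIV) (\<lambda>w. G (fst w) (snd w) powr q)"
    by (rule continuous_on_powr'[OF cG continuous_on_const]) (use q_pos in \<open>auto simp: G_def\<close>)
  have cV: "continuous_on ({0..} \<times> UNIV) (\<lambda>w. V (fst w) (snd w))"
    unfolding V_def by (intro continuous_intros cG cGq)
  have cL: "continuous_on {0..} L"
  proof -
    have "continuous_on {0..} (c s)" if "p - 1 < s" for s
    proof -
      have "continuous_on {0..} M" unfolding M_def by (intro continuous_intros)
      then have "continuous_on {0..} (\<lambda>t. M t powr (s / (p - 1) - 1))"
        by (rule continuous_on_powr'[OF _ continuous_on_const]) (use that p1 M0 in auto)
      then show ?thesis unfolding c_def by (intro continuous_on_mult_left)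
    qed
    from this[of 1] this[of q] show ?thesis
      unfolding L_def using p2 q1 by (intro continuous_intros) auto
  qed
  have lip: "norm (V t x - V t y) \<le> L t * norm (x - y)" if t: "0 \<le> t" for t x y
  proof -
    have G: "\<bar>G t x powr s - G t y powr s\<bar> \<le> c s t * norm (x - y)" if s: "p - 1 < s" for s
    proof -
      have "\<bar>G t x powr s - G t y powr s\<bar> \<le> c s t * \<bar>min (snd x) (M t) - min (snd y) (M t)\<bar>"
        unfolding G_def c_def by (rule gam_lipschitz) (use s M0[OF t] in auto)
      also have "\<dots> \<le> c s t * norm (x - y)"
      proof (rule mult_left_mono)
        have "\<bar>min (snd x) (M t) - min (snd y) (M t)\<bar> \<le> \<bar>snd (x - y)\<bar>" by auto
        also have "\<dots> \<le> norm (x - y)" 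
          using norm_snd_le[of "snd (x - y)" "fst (x - y)"] by (simp del: fst_diff snd_diff)
        finally show "\<bar>min (snd x) (M t) - min (snd y) (M t)\<bar> \<le> norm (x - y)" .
        show "0 \<le> c s t" using s p1 by (simp add: c_def)
      qed
      finally show ?thesis .
    qed
    have G1: "\<bar>G t x - G t y\<bar> \<le> c 1 t * norm (x - y)" using G[of 1] p2 by (simp add: G_def)
    have Gq: "\<bar>G t x powr q - G t y powr q\<bar> \<le> c q t * norm (x - y)" using G[of q] q1 by simp
    have x: "\<bar>fst x - fst y\<bar> \<le> norm (x - y)"
      using norm_fst_le[of "fst (x - y)" "snd (x - y)"] by (simp flip: fst_diff del: snd_diff)
    have "norm (V t x - V t y) \<le> \<bar>G t x - G t y\<bar> +
      \<bar>k * (\<alpha> * (fst x - fst y) - \<beta> * t * (G t x - G t y)) - (G t x powr q - G t y powr q)\<bar>"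
      using norm_Pair_le[of "- G t x + G t y"
        "k * (\<alpha> * (fst x - fst y) - \<beta> * t * (G t x - G t y)) - (G t x powr q - G t y powr q)"]
      by (simp add: V_def algebra_simps abs_minus_commute)
    also have "\<bar>k * (\<alpha> * (fst x - fst y) - \<beta> * t * (G t x - G t y)) - (G t x powr q - G t y powr q)\<bar>
      \<le> \<bar>k * (\<alpha> * (fst x - fst y) - \<beta> * t * (G t x - G t y))\<bar> + \<bar>G t x powr q - G t y powr q\<bar>"
      by (rule abs_triangle_ineq4)
    also have "\<bar>k * (\<alpha> * (fst x - fst y) - \<beta> * t * (G t x - G t y))\<bar> \<le>
      k * (\<alpha> * \<bar>fst x - fst y\<bar> + \<beta> * t * \<bar>G t x - G t y\<bar>)"
      using abs_triangle_ineq4[of "\<alpha> * (fst x - fst y)" "\<beta> * t * (G t x - G t y)"] k alpha_pos beta_pos t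
      by (simp add: abs_mult)
    also have "\<dots> \<le> k * (\<alpha> * norm (x - y) + \<beta> * t * (c 1 t * norm (x - y)))"
      using x G1 k alpha_pos beta_pos t by (intro mult_left_mono add_mono) auto
    finally have "norm (V t x - V t y) \<le> c 1 t * norm (x - y) +
      (k * (\<alpha> * norm (x - y) + \<beta> * t * (c 1 t * norm (x - y))) + c q t * norm (x - y))"
      using G1 Gq by linarith
    also have "\<dots> = (c 1 t + (k * (\<alpha> + \<beta> * t * c 1 t) + c q t)) * norm (x - y)"
      by (simp add: algebra_simps)
    also have "\<dots> \<le> L t * norm (x - y)"
      using k a alpha_pos by (intro mult_right_mono) (auto simp: L_def)
    finally show ?thesis .
  qed
  have bd: "norm (V t (a, 0)) \<le> L t" if t: "0 \<le> t" for t
  proof -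
    have "V t (a, 0) = (0, k * \<alpha> * a)"
      using M0[OF t] by (simp add: V_def G_def gam_nonpos)
    moreover have "0 \<le> c 1 t + (k * (\<alpha> + \<beta> * t * c 1 t) + c q t)"
      using k alpha_pos beta_pos t p1 q_pos by (simp add: c_def)
    ultimately show ?thesis
      using k a alpha_pos norm_Pair_le[of 0 "k * \<alpha> * a"] by (simp add: L_def)
  qed
  obtain u where u0: "u 0 = (a, 0)" and
    u: "\<And>t. 0 \<le> t \<Longrightarrow> (u has_vector_derivative V t (u t)) (at t within {0..})"
    using picard_lindelof_Ici[OF cV cL lip bd] by blast
  define f where "f = (\<lambda>t. fst (u t))"
  define F where "F = (\<lambda>t. snd (u t))"
  have df: "(f has_real_derivative - G t (u t)) (at t within {0..})"
    and dF: "(F has_real_derivative k * (\<alpha> * f t - \<beta> * t * G t (u t)) - G t (u t) powr q) (at t within {0..})"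
    if "0 \<le> t" for t
  proof -
    have D: "(u has_derivative (\<lambda>x. x *\<^sub>R V t (u t))) (at t within {0..})"
      using u[OF that] by (simp add: has_vector_derivative_def)
    show "(f has_real_derivative - G t (u t)) (at t within {0..})"
      unfolding f_def has_field_derivative_def
      by (rule has_derivative_eq_rhs[OF has_derivative_fst[OF D]]) (auto simp: V_def)
    show "(F has_real_derivative k * (\<alpha> * f t - \<beta> * t * G t (u t)) - G t (u t) powr q) (at t within {0..})"
      unfolding f_def F_def has_field_derivative_def
      by (rule has_derivative_eq_rhs[OF has_derivative_snd[OF D]]) (auto simp: V_def)
  qed
  have G0: "0 \<le> G t z" for t z by (simp add: G_def)
  have fa: "f t \<le> a" if "0 \<le> t" for t
    using antimono_Ici[OF df, of 0 t] G0 that u0 by (simp add: f_def)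
  \<comment> \<open>The estimate of \<open>F_le\<close> holds for the cut-off system as well, so the
    cut-off is never active along the solution.\<close>
  have F: "F t \<le> M t" if t: "0 \<le> t" for t
  proof -
    have "F t - M t \<le> F 0 - M 0"
    proof (rule antimono_Ici[OF _ _ _ t])
      show "((\<lambda>t. F t - M t) has_real_derivative
        (k * (\<alpha> * f r - \<beta> * r * G r (u r)) - G r (u r) powr q) - k * \<alpha> * a) (at r within {0..})"
        if "0 \<le> r" for r
        unfolding M_def by (rule derivative_eq_intros dF[OF that] refl | simp)+
      fix r :: real assume r: "0 < r"
      have "k * (\<alpha> * f r - \<beta> * r * G r (u r)) \<le> k * (\<alpha> * a)"
        using fa[of r] r k alpha_pos beta_pos G0[of r "u r"]
        by (intro mult_left_mono) (auto intro: add_increasing2 simp: diff_le_eq)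
      then show "(k * (\<alpha> * f r - \<beta> * r * G r (u r)) - G r (u r) powr q) - k * \<alpha> * a \<le> 0"
        using powr_ge_zero[of "G r (u r)" q] by (simp add: mult.assoc del: powr_ge_zero)
    qed simp
    then show ?thesis using u0 by (simp add: F_def M_def)
  qed
  have "G t (u t) = gam (F t)" if "0 \<le> t" for t
    using F[OF that] by (simp add: G_def F_def)
  then have "sol k a f F" using df dF u0 by (auto simp: sol_def f_def F_def)
  then show ?thesis by blast
qed

section \<open>The sign of the drift along a solution\<close>

definition drift :: "(real \<Rightarrow> real) \<Rightarrow> (real \<Rightarrow> real) \<Rightarrow> real \<Rightarrow> real" where
  "drift f F r = \<alpha> * f r - \<beta> * r * gam (F r)"

lemma DERIV_F:
  "sol k a f F \<Longrightarrow> 0 < r \<Longrightarrow> (F has_real_derivative k * drift f F r - gam (F r) powr q) (at r)"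
  using sol_F_at by (simp add: drift_def)

lemma DERIV_drift:
  assumes s: "sol k a f F" and r: "0 < r"
  shows "(drift f F has_real_derivative - (\<alpha> + \<beta>) * gam (F r) -
    \<beta> * r * (gam (F r) powr (2 - p) / (p - 1) * (k * drift f F r - gam (F r) powr q))) (at r)"
proof -
  have "((\<lambda>r. \<alpha> * f r - \<beta> * r * gam (F r)) has_real_derivative - (\<alpha> + \<beta>) * gam (F r) -
    \<beta> * r * (gam (F r) powr (2 - p) / (p - 1) * (k * drift f F r - gam (F r) powr q))) (at r)"
    by (rule derivative_eq_intros sol_f_at[OF s r] DERIV_gam[OF DERIV_F[OF s r]] refl
        | simp add: algebra_simps)+
  then show ?thesis by (simp add: drift_def[abs_def])
qed

lemma drift_cont: "sol k a f F \<Longrightarrow> continuous_on {0..} (drift f F)"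
  unfolding drift_def[abs_def] by (intro continuous_intros sol_cont)

lemma F_pos:
  assumes s: "sol k a f F" and k: "0 < k" and t: "0 < t" and f: "0 < f t"
  shows "0 < F t"
proof (rule pos_of_DERIV_pos_at_zeros[OF sol_F[OF s] sol_0(2)[OF s] t])
  fix r assume r: "0 \<le> r" "r \<le> t" "F r = 0"
  then have "0 < f r" using sol_antimono[OF s r(1,2)] f by simp
  then show "0 < k * (\<alpha> * f r - \<beta> * r * gam (F r)) - gam (F r) powr q"
    using k alpha_pos r(3) by (simp add: gam_nonpos)
qed

text \<open>Up to a power of \<open>r\<close>, the product rule gives
  \<open>\<mu> * f - r * gam F\<close>, which \<open>\<alpha> = \<beta> * \<mu>\<close> turns into
  the drift.\<close>

lemma DERIV_Y:
  assumes s: "sol k a f F" and r: "0 < r"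
  shows "((\<lambda>r. r powr \<mu> * f r) has_real_derivative r powr (\<mu> - 1) / \<beta> * drift f F r) (at r)"
proof -
  have "r powr \<mu> = r powr (\<mu> - 1) * r" using r powr_add[of r "\<mu> - 1" 1] by simp
  then have "\<mu> * r powr (\<mu> - 1) * f r + r powr \<mu> * - gam (F r) = r powr (\<mu> - 1) / \<beta> * drift f F r"
    using beta_pos by (simp add: drift_def alpha_eq field_simps)
  then show ?thesis
    using r by (auto intro!: derivative_eq_intros sol_f_at[OF s r] simp: mult.commute[of "gam _"])
qed

text \<open>At a zero of \<open>drift\<close> the curve \<open>r\<^sup>\<mu> f(r)\<close> is critical, with a minimum above the level \<open>K\<close> of the
  singular stationary solution and a maximum below it.\<close>

lemma drift_zero:
  assumes s: "sol k a f F" and r: "0 < r" and z: "drift f F r = 0" and F: "0 < F r"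
  obtains d where "(drift f F has_real_derivative d) (at r)"
    "r powr \<mu> * f r < K \<Longrightarrow> d < 0" "K < r powr \<mu> * f r \<Longrightarrow> 0 < d"
proof
  let ?g = "gam (F r)"
  let ?v = "(r powr (\<mu> + 1) * ?g) powr (q - p + 1)"
  let ?d = "\<beta> / (p - 1) * ?g * (?v - (p - 1) * (\<mu> + 1))"
  have g: "0 < ?g" using F by (simp add: gam_pos)
  have v: "?v = r * ?g powr (q - p + 1)"
    using r g mu1 by (simp add: powr_mult powr_powr)
  have "?g powr (2 - p) * ?g powr q = ?g * ?g powr (q - p + 1)"
    using g powr_add[of ?g 1 "q - p + 1"] by (simp add: powr_add[symmetric] algebra_simps)
  \<comment> \<open>As the drift vanishes, only the absorption term of \<open>F'\<close>
    remains.\<close>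
  then have "?d = - (\<alpha> + \<beta>) * ?g - \<beta> * r * (?g powr (2 - p) / (p - 1) * (k * drift f F r - ?g powr q))"
    using p1 unfolding v z by (simp add: alpha_eq field_simps)
  then show "(drift f F has_real_derivative ?d) (at r)" using DERIV_drift[OF s r] by simp
  \<comment> \<open>A vanishing drift ties height to slope: comparing the curve with
    \<open>K\<close> is comparing \<open>r powr (\<mu> + 1) * gam (F r)\<close> with
    \<open>slope_lim\<close>.\<close>
  have "r powr \<mu> * f r = r powr (\<mu> + 1) * ?g / \<mu>"
    using z beta_pos mu_pos r by (simp add: drift_def alpha_eq powr_add field_simps)
  then have Y: "r powr \<mu> * f r < K \<longleftrightarrow> r powr (\<mu> + 1) * ?g < slope_lim"
    "K < r powr \<mu> * f r \<longleftrightarrow> slope_lim < r powr (\<mu> + 1) * ?g"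
    using mu_pos by (auto simp: K_eq divide_strict_right_mono divide_less_cancel)
  have pos: "0 < \<beta> / (p - 1) * ?g" using beta_pos p1 g by simp
  show "?d < 0" if "r powr \<mu> * f r < K"
  proof -
    have "?v < slope_lim powr (q - p + 1)"
      using that Y q1 r g by (intro powr_less_mono2) auto
    then have "?v - (p - 1) * (\<mu> + 1) < 0" using slope_lim_powr by simp
    with pos show ?thesis by (rule mult_pos_neg)
  qed
  show "0 < ?d" if "K < r powr \<mu> * f r"
  proof -
    have "slope_lim powr (q - p + 1) < ?v"
      using that Y q1 r g slope_lim_pos by (intro powr_less_mono2) auto
    then have "0 < ?v - (p - 1) * (\<mu> + 1)" using slope_lim_powr by simp
    with pos show ?thesis by (rule mult_pos_pos)
  qed
qed

lemma Y_antimono: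
  assumes s: "sol k a f F" and st: "0 < s" "s \<le> t"
    and E: "\<And>r. s < r \<Longrightarrow> r < t \<Longrightarrow> drift f F r \<le> 0"
  shows "t powr \<mu> * f t \<le> s powr \<mu> * f s"
proof -
  have "- (s powr \<mu> * f s) \<le> - (t powr \<mu> * f t)"
  proof (rule mono_pos[of "\<lambda>r. - (r powr \<mu> * f r)" "\<lambda>r. - (r powr (\<mu> - 1) / \<beta> * drift f F r)"])
    show "0 \<le> - (r powr (\<mu> - 1) / \<beta> * drift f F r)" if "s < r" "r < t" for r
      using E[OF that] beta_pos mult_nonneg_nonpos[of "r powr (\<mu> - 1) / \<beta>" "drift f F r"] by simp
  qed (use DERIV_minus[OF DERIV_Y[OF s]] st in auto)
  then show ?thesis by simp
qed

lemma Y_strict_antimono: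
  assumes s: "sol k a f F" and st: "0 < s" "s < t"
    and E: "\<And>r. s < r \<Longrightarrow> r < t \<Longrightarrow> drift f F r < 0"
  shows "t powr \<mu> * f t < s powr \<mu> * f s"
proof (rule DERIV_neg_imp_decreasing_open[OF st(2)])
  show "\<exists>y. ((\<lambda>r. r powr \<mu> * f r) has_real_derivative y) (at x) \<and> y < 0" if "s < x" "x < t" for x
    using DERIV_Y[OF s, of x] E[OF that] that st beta_pos
    by (intro exI[of _ "x powr (\<mu> - 1) / \<beta> * drift f F x"]) (simp add: mult_pos_neg divide_neg_pos)
  show "continuous_on {s..t} (\<lambda>r. r powr \<mu> * f r)"
    using DERIV_Y[OF s] st
    by (intro DERIV_continuous_on[of _ _ "\<lambda>r. r powr (\<mu> - 1) / \<beta> * drift f F r"])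
      (auto intro: has_field_derivative_at_within)
qed

lemma Y_mono:
  assumes s: "sol k a f F" and st: "0 < s" "s \<le> t"
    and E: "\<And>r. s < r \<Longrightarrow> r < t \<Longrightarrow> 0 \<le> drift f F r"
  shows "s powr \<mu> * f s \<le> t powr \<mu> * f t"
  by (rule mono_pos[of "\<lambda>r. r powr \<mu> * f r" "\<lambda>r. r powr (\<mu> - 1) / \<beta> * drift f F r"])
    (use DERIV_Y[OF s] st E beta_pos in auto)

text \<open>Just after the last zero \<open>c\<close> of the drift before \<open>r\<close> the drift
  is negative. So the curve has no minimum at \<open>c\<close>, is at most \<open>K\<close> there
  and falls below \<open>K\<close> afterwards. At a new zero the drift would then be decreasing,
  although it comes from negative values.\<close>

lemma drift_neg_persists:
  assumes s: "sol k a f F" and k: "0 < k" and a: "0 < a"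
    and r: "0 \<le> r" "drift f F r < 0" and t: "r \<le> t" "0 < f t"
  shows "drift f F t < 0" and "t powr \<mu> * f t < K"
    and "t powr \<mu> * f t \<le> r powr \<mu> * f r"
proof -
  have "0 < drift f F 0" using sol_0[OF s] a alpha_pos by (simp add: drift_def)
  moreover have "continuous_on {0..r} (drift f F)"
    by (rule continuous_on_subset[OF drift_cont[OF s]]) auto
  ultimately obtain c where c: "0 < c" "c < r" "drift f F c = 0"
    and neg: "\<And>s. c < s \<Longrightarrow> s \<le> r \<Longrightarrow> drift f F s < 0"
    using last_zero[of 0 r "drift f F"] r by metis
  have Fp: "0 < F s" if "c \<le> s" "s \<le> t" for s
    using sol_antimono[OF s, of s t] that c t by (intro F_pos[OF s k]) auto
  have cK: "c powr \<mu> * f c \<le> K"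
  proof (rule ccontr)
    assume "\<not> ?thesis"
    then obtain d where "(drift f F has_real_derivative d) (at c)" "0 < d"
      using drift_zero[OF s c(1,3)] Fp[of c] c t by (metis less_eq_real_def not_le order_trans)
    from has_real_derivative_pos_inc_right[OF this] obtain e
      where e: "0 < e" "\<And>h. 0 < h \<Longrightarrow> h < e \<Longrightarrow> 0 < drift f F (c + h)" using c(3) by auto
    define h where "h = min (e / 2) (r - c)"
    have "0 < h" "h < e" "c + h \<le> r" using e(1) c(2) by (auto simp: h_def)
    then show False using e(2)[of h] neg[of "c + h"] by simp
  qed
  have pers: "0 < - drift f F w" if w: "r \<le> w" "w \<le> t" for w
  proof (rule pos_persists[of r t "\<lambda>r. - drift f F r" w])
    show "continuous_on {r..t} (\<lambda>r. - drift f F r)"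
      by (intro continuous_intros continuous_on_subset[OF drift_cont[OF s]]) (use r in auto)
    show "0 < - drift f F r" using r by simp
    fix s' assume s': "r < s'" "s' \<le> t" "- drift f F s' = 0"
      and n: "\<And>s. r \<le> s \<Longrightarrow> s < s' \<Longrightarrow> 0 < - drift f F s"
    have "s' powr \<mu> * f s' < c powr \<mu> * f c"
    proof (rule Y_strict_antimono[OF s c(1)])
      show "c < s'" using c s' by simp
      show "drift f F x < 0" if "c < x" "x < s'" for x
        using neg[of x] n[of x] that by (cases "x \<le> r") auto
    qed
    then have "s' powr \<mu> * f s' < K" using cK by simp
    then obtain d where "(drift f F has_real_derivative d) (at s')" "d < 0"
      using drift_zero[OF s, of s'] Fp[of s'] c s' r by (smt (verit, best))
    then show "\<exists>d>0. ((\<lambda>r. - drift f F r) has_real_derivative d) (at s')"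
      by (intro exI[of _ "- d"]) (auto intro: DERIV_minus)
  qed (use w in auto)
  show "drift f F t < 0" using pers[of t] t by simp
  have "t powr \<mu> * f t < c powr \<mu> * f c"
  proof (rule Y_strict_antimono[OF s c(1)])
    show "c < t" using c t by simp
    show "drift f F x < 0" if "c < x" "x < t" for x
      using neg[of x] pers[of x] that by (cases "x \<le> r") auto
  qed
  then show "t powr \<mu> * f t < K" using cK by simp
  show "t powr \<mu> * f t \<le> r powr \<mu> * f r"
    by (rule Y_antimono[OF s]) (use pers c t in \<open>auto intro: less_imp_le\<close>)
qed

section \<open>Critical solutions\<close>

text \<open>Continuity gives positivity near \<open>0\<close>; from there on
  \<open>r powr \<mu> * f r\<close> does not decrease.\<close>

lemma sol_pos:
  assumes s: "sol k a f F" and a: "0 < a" and E: "\<And>r. 0 \<le> r \<Longrightarrow> 0 \<le> drift f F r" and t: "0 \<le> t"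
  shows "0 < f t"
proof -
  have "continuous (at 0 within {0..}) f"
    using sol_cont(1)[OF s] by (simp add: continuous_on_eq_continuous_within)
  then obtain d where d: "0 < d" "\<And>x. 0 \<le> x \<Longrightarrow> x < d \<Longrightarrow> \<bar>f x - f 0\<bar> < a"
    using a by (auto simp: continuous_within_eps_delta dist_real_def)
  have near: "0 < f x" if "0 \<le> x" "x < d" for x
    using d(2)[OF that] sol_0[OF s] by linarith
  show ?thesis
  proof (cases "t < d")
    case False
    have "0 < (d / 2) powr \<mu> * f (d / 2)" using near[of "d / 2"] d(1) by simp
    also have "\<dots> \<le> t powr \<mu> * f t"
      by (rule Y_mono[OF s]) (use E d(1) False in auto)
    finally show ?thesis using zero_less_mult_pos[of "t powr \<mu>" "f t"] d(1) False by auto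
  qed (use near t in simp)
qed

text \<open>The starting value lies in neither of the two open sets of the shooting
  argument.\<close>

definition critical :: "(real \<Rightarrow> real) \<Rightarrow> (real \<Rightarrow> real) \<Rightarrow> bool" where
  "critical f F \<longleftrightarrow> (\<forall>r\<ge>0. 0 \<le> drift f F r) \<and> (\<forall>r>0. r powr \<mu> * f r \<le> K)"

definition scaled_slope :: "(real \<Rightarrow> real) \<Rightarrow> real \<Rightarrow> real" where
  "scaled_slope F r = r powr (\<mu> + 1) * gam (F r)"

lemma scaled_slope_nonneg: "0 \<le> scaled_slope F r" by (simp add: scaled_slope_def)

lemma scaled_slope_le:
  assumes "0 < r" "0 \<le> drift f F r"
  shows "scaled_slope F r \<le> \<mu> * (r powr \<mu> * f r)"
proof -
  have "\<beta> * (r * gam (F r)) \<le> \<beta> * (\<mu> * f r)" using assms(2) by (simp add: drift_def alpha_eq mult.assoc)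
  then have "r powr \<mu> * (r * gam (F r)) \<le> r powr \<mu> * (\<mu> * f r)"
    using beta_pos by (intro mult_left_mono) auto
  then show ?thesis using assms(1) by (simp add: scaled_slope_def powr_add mult_ac)
qed

lemma scaled_slope_powr:
  assumes "0 \<le> F r" "0 < r"
  shows "scaled_slope F r powr (p - 1) = r powr ((\<mu> + 1) * (p - 1)) * F r"
  using assms gam_powr_p1 by (simp add: scaled_slope_def powr_mult powr_powr)

text \<open>The power \<open>p - 1\<close> turns \<open>gam F\<close> back into \<open>F\<close>,
  whose equation is known. In the variable \<open>ln r\<close> the result is an equation of logistic
  type with equilibrium \<open>slope_lim\<close>, driven by the drift.\<close>

lemma DERIV_scaled_slope_powr:
  assumes s: "sol k a f F" and F: "\<And>r. 0 < r \<Longrightarrow> 0 < F r" and r: "0 < r"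
  shows "((\<lambda>r. scaled_slope F r powr (p - 1)) has_real_derivative
    (scaled_slope F r powr (p - 1) * ((p - 1) * (\<mu> + 1) - scaled_slope F r powr (q - p + 1)) +
      k * r powr (q * (\<mu> + 1)) * drift f F r) / r) (at r)"
proof -
  let ?n = "(\<mu> + 1) * (p - 1)"
  let ?g = "gam (F r)"
  have n: "r powr ?n * r = r powr (q * (\<mu> + 1))"
    using mu_q r powr_add[of r ?n 1] by (simp add: mult.commute)
  have "((\<lambda>r. r powr ?n * F r) has_real_derivative
    ?n * r powr (?n - 1) * F r + r powr ?n * (k * drift f F r - ?g powr q)) (at r)"
    using r by (auto intro!: derivative_eq_intros DERIV_F[OF s r] simp: algebra_simps)
  moreover have "scaled_slope F r powr (p - 1) * scaled_slope F r powr (q - p + 1) = r powr ?n * r * ?g powr q"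
  proof -
    have "scaled_slope F r powr (p - 1) * scaled_slope F r powr (q - p + 1) = scaled_slope F r powr q"
      by (simp flip: powr_add)
    also have "\<dots> = r powr (q * (\<mu> + 1)) * ?g powr q"
      using r by (simp add: scaled_slope_def powr_mult powr_powr mult.commute[of q])
    finally show ?thesis by (simp add: n)
  qed
  moreover have "r powr (?n - 1) * F r = scaled_slope F r powr (p - 1) / r"
    using scaled_slope_powr[of F r] F[OF r] r by (simp add: powr_diff)
  moreover have "n * (u / r) + w * (k * e - v) = (u * (n - z) + k * (w * r) * e) / r"
    if "u * z = w * r * v" for n u v w z e
    using r that by (simp add: field_simps)
  ultimately have "((\<lambda>r. r powr ?n * F r) has_real_derivative
    (scaled_slope F r powr (p - 1) * ((p - 1) * (\<mu> + 1) - scaled_slope F r powr (q - p + 1)) +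
      k * r powr (q * (\<mu> + 1)) * drift f F r) / r) (at r)"
    unfolding n[symmetric] mult.assoc[of ?n] by (simp only: mult.commute[of "p - 1"])
  then show ?thesis
    by (rule has_field_derivative_transform_within_open[of _ _ _ "{0<..}"])
      (use r in \<open>auto simp: scaled_slope_powr F less_imp_le\<close>)
qed

text \<open>A nonnegative drift bounds \<open>scaled_slope\<close> by \<open>\<mu>\<close> times the
  curve, hence by \<open>slope_lim\<close>. Both terms of the logistic equation are then
  nonnegative, so the scaled slope does not decrease. If it stayed below some
  \<open>x < slope_lim\<close>, its power would grow at least like \<open>ln r\<close>. So it comes
  arbitrarily close to \<open>slope_lim\<close> and squeezes the curve, which is at least
  \<open>scaled_slope / \<mu>\<close>, towards \<open>K\<close>.\<close>

lemma
  assumes s: "sol k a f F" and k: "0 < k" and a: "0 < a" and c: "critical f F"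
  shows critical_F_pos: "0 < r \<Longrightarrow> 0 < F r"
    and critical_scaled_slope_le: "0 < r \<Longrightarrow> scaled_slope F r \<le> slope_lim"
    and critical_scaled_slope_mono: "0 < r \<Longrightarrow> r \<le> t \<Longrightarrow> scaled_slope F r \<le> scaled_slope F t"
    and critical_Y_tendsto: "((\<lambda>r. r powr \<mu> * f r) \<longlongrightarrow> K) at_top"
proof -
  have E: "0 \<le> drift f F r" if "0 \<le> r" for r using c that by (auto simp: critical_def)
  have Y: "r powr \<mu> * f r \<le> K" if "0 < r" for r using c that by (auto simp: critical_def)
  show Fp: "0 < F r" if "0 < r" for r using F_pos[OF s k that] sol_pos[OF s a E, of r] that by simp
  show X: "scaled_slope F r \<le> slope_lim" if r: "0 < r" for r
  proof -
    have "scaled_slope F r \<le> \<mu> * (r powr \<mu> * f r)" using scaled_slope_le[OF r] E[of r] r by simp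
    also have "\<dots> \<le> \<mu> * K" using Y[OF r] mu_pos by simp
    finally show ?thesis using mu_pos by (simp add: K_eq)
  qed
  define D where "D = (\<lambda>r. (scaled_slope F r powr (p - 1) * ((p - 1) * (\<mu> + 1) - scaled_slope F r powr (q - p + 1)) +
      k * r powr (q * (\<mu> + 1)) * drift f F r) / r)"
  have dZ: "((\<lambda>r. scaled_slope F r powr (p - 1)) has_real_derivative D r) (at r)" if "0 < r" for r
    unfolding D_def using DERIV_scaled_slope_powr[OF s Fp that] by simp
  have Xq: "scaled_slope F r powr (q - p + 1) \<le> (p - 1) * (\<mu> + 1)" if "0 < r" for r
    using powr_mono2[of "q - p + 1" "scaled_slope F r" slope_lim] X[OF that] q1 slope_lim_powr scaled_slope_nonneg[of F r] by simp
  have D0: "0 \<le> D r" if "0 < r" for r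
    unfolding D_def using Xq[OF that] E[of r] k that by (intro divide_nonneg_pos add_nonneg_nonneg) auto
  show mono: "scaled_slope F r \<le> scaled_slope F t" if "0 < r" "r \<le> t" for r t
  proof -
    have "scaled_slope F r powr (p - 1) \<le> scaled_slope F t powr (p - 1)"
      by (rule mono_pos[OF dZ]) (use that D0 in auto)
    then show ?thesis
      using powr_less_mono2[of "p - 1" "scaled_slope F t" "scaled_slope F r"] p1 scaled_slope_nonneg[of F t] by force
  qed
  have lim: "\<exists>r>0. x < scaled_slope F r" if x: "x < slope_lim" for x
  proof (rule ccontr)
    assume "\<not> ?thesis"
    then have le: "scaled_slope F r \<le> x" if "0 < r" for r using that by force
    have x1: "0 < scaled_slope F 1" using Fp[of 1] by (simp add: scaled_slope_def gam_pos)
    have x0: "0 < x" using le[of 1] x1 by simp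
    \<comment> \<open>A lower bound, uniform in \<open>r > 1\<close>, for \<open>r\<close> times the
      derivative of the power.\<close>
    define d where "d = scaled_slope F 1 powr (p - 1) * ((p - 1) * (\<mu> + 1) - x powr (q - p + 1))"
    have "x powr (q - p + 1) < (p - 1) * (\<mu> + 1)"
      using powr_less_mono2[of "q - p + 1" x slope_lim] x x0 q1 slope_lim_powr by simp
    then have d: "0 < d" using x1 by (simp add: d_def)
    have *: "d * ln t \<le> slope_lim powr (p - 1)" if t: "1 \<le> t" for t
    proof -
      have "scaled_slope F 1 powr (p - 1) - d * ln 1 \<le> scaled_slope F t powr (p - 1) - d * ln t"
      proof (rule mono_pos[OF _ _ _ t])
        show "((\<lambda>r. scaled_slope F r powr (p - 1) - d * ln r) has_real_derivative D r - d * inverse r) (at r)"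
          if "0 < r" for r
          using DERIV_diff[OF dZ[OF that] DERIV_cmult[OF DERIV_ln[OF that]]] by simp
        fix r :: real assume r: "1 < r"
        have "d \<le> scaled_slope F r powr (p - 1) * ((p - 1) * (\<mu> + 1) - scaled_slope F r powr (q - p + 1))"
          unfolding d_def using mono[of 1 r] le[of r] r p1 q1 x1 Xq[of r] scaled_slope_nonneg[of F r] x0
          \<open>x powr (q - p + 1) < (p - 1) * (\<mu> + 1)\<close>
          by (intro mult_mono diff_left_mono powr_mono2) auto
        moreover have "0 \<le> k * r powr (q * (\<mu> + 1)) * drift f F r" using k E[of r] r by simp
        ultimately have "d / r \<le> D r" unfolding D_def using r by (intro divide_right_mono) auto
        then show "0 \<le> D r - d * inverse r" by (simp add: divide_inverse)
      qed simp
      moreover have "scaled_slope F t powr (p - 1) \<le> slope_lim powr (p - 1)"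
        using X[of t] t p1 scaled_slope_nonneg[of F t] by (intro powr_mono2) auto
      moreover have "0 \<le> scaled_slope F 1 powr (p - 1)" by simp
      ultimately show ?thesis unfolding ln_one by linarith
    qed
    let ?T = "(slope_lim powr (p - 1) + 1) / d"
    have "d * ln (exp ?T) \<le> slope_lim powr (p - 1)"
      by (rule *) (use d in simp)
    then show False using d by simp
  qed
  show "((\<lambda>r. r powr \<mu> * f r) \<longlongrightarrow> K) at_top"
  proof (rule order_tendstoI)
    fix y assume "y < K"
    then have "\<mu> * y < slope_lim" using mu_pos by (simp add: K_eq field_simps)
    then obtain r where r: "0 < r" "\<mu> * y < scaled_slope F r" using lim by blast
    have "y < t powr \<mu> * f t" if "r \<le> t" for t
    proof -
      have "\<mu> * y < scaled_slope F t" using r mono[OF r(1) that] by simp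
      also have "\<dots> \<le> \<mu> * (t powr \<mu> * f t)" using scaled_slope_le[of t f F] E[of t] r that by simp
      finally show ?thesis using mu_pos by simp
    qed
    then show "\<forall>\<^sub>F t in at_top. y < t powr \<mu> * f t"
      by (auto simp: eventually_at_top_linorder)
  next
    fix y assume y: "K < y"
    show "\<forall>\<^sub>F t in at_top. t powr \<mu> * f t < y"
      using eventually_gt_at_top[of 0] by eventually_elim (use Y y in force)
  qed
qed

text \<open>Once the drift is negative, the curve is below \<open>K\<close> and does not rise again,
  which excludes the limit \<open>K\<close>. So the drift is nonnegative and the curve approaches
  its limit from below.\<close>

lemma tendsto_imp_critical:
  assumes s: "sol k a f F" and k: "0 < k" and a: "0 < a" and f: "\<And>r. 0 < r \<Longrightarrow> 0 < f r"
    and lim: "((\<lambda>r. r powr \<mu> * f r) \<longlongrightarrow> K) at_top"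
  shows "critical f F"
proof -
  have E: "0 \<le> drift f F r" if r: "0 \<le> r" for r
  proof (rule ccontr)
    assume "\<not> ?thesis"
    then have n: "drift f F r < 0" by simp
    have "0 < drift f F 0" using sol_0[OF s] a alpha_pos by (simp add: drift_def)
    then have r0: "0 < r" using n r by (cases "r = 0") auto
    have "K \<le> r powr \<mu> * f r"
    proof (rule tendsto_upperbound[OF lim])
      show "\<forall>\<^sub>F t in at_top. t powr \<mu> * f t \<le> r powr \<mu> * f r"
        using eventually_ge_at_top[of r]
        by eventually_elim (use drift_neg_persists(3)[OF s k a r n] f r0 in force)
    qed simp
    moreover have "r powr \<mu> * f r < K"
      using drift_neg_persists(2)[OF s k a r n, of r] f[OF r0] by simp
    ultimately show False by simp
  qed
  moreover have "r powr \<mu> * f r \<le> K" if r: "0 < r" for r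
  proof (rule tendsto_lowerbound[OF lim])
    show "\<forall>\<^sub>F t in at_top. r powr \<mu> * f r \<le> t powr \<mu> * f t"
      using eventually_ge_at_top[of r]
      by eventually_elim (use Y_mono[OF s r] E r in force)
  qed simp
  ultimately show ?thesis by (simp add: critical_def)
qed

section \<open>Energy bound and small starting values\<close>

text \<open>In the derivative the terms \<open>\<alpha> * f * gam F\<close> cancel, and
  \<open>- gam F * (\<beta> * r * gam F + gam F powr q)\<close> is left.\<close>

lemma energy:
  assumes s: "sol 1 a f F" and r: "0 \<le> r"
  shows "\<alpha> / 2 * (f r)\<^sup>2 + (p - 1) / p * gam (F r) powr p \<le> \<alpha> / 2 * a\<^sup>2"
proof -
  define h' where "h' = (\<lambda>r. \<alpha> / 2 * (2 * f r * - gam (F r)) +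
    (p - 1) / p * (p / (p - 1) * gam (F r) powr 1 * (drift f F r - gam (F r) powr q)))"
  have "\<alpha> / 2 * (f r)\<^sup>2 + (p - 1) / p * gam (F r) powr p \<le>
      \<alpha> / 2 * (f 0)\<^sup>2 + (p - 1) / p * gam (F 0) powr p"
  proof (rule antimono_Ici[of "\<lambda>r. \<alpha> / 2 * (f r)\<^sup>2 + (p - 1) / p * gam (F r) powr p" h'])
    fix r :: real assume r: "0 \<le> r"
    have "((\<lambda>r. gam (F r) powr p) has_real_derivative
        p / (p - 1) * gam (F r) powr (p + 1 - p) * (drift f F r - gam (F r) powr q)) (at r within {0..})"
      by (rule DERIV_gam_powr) (use sol_F[OF s r] in \<open>auto simp: drift_def\<close>)
    from DERIV_add[OF DERIV_cmult[OF DERIV_power[OF sol_f[OF s r], of 2]] DERIV_cmult[OF this]]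
    show "((\<lambda>r. \<alpha> / 2 * (f r)\<^sup>2 + (p - 1) / p * gam (F r) powr p) has_real_derivative h' r)
        (at r within {0..})"
      by (rule DERIV_cong) (simp add: h'_def)
  next
    fix x assume x: "0 < x" "x < r"
    have "h' x = gam (F x) * (drift f F x - \<alpha> * f x - gam (F x) powr q)"
    proof -
      have "(p - 1) / p * (p / (p - 1) * gam (F x) powr 1 * w) = gam (F x) * w" for w
        using p1 by simp
      then show ?thesis by (simp only: h'_def) (simp add: algebra_simps)
    qed
    also have "\<dots> \<le> 0"
    proof (rule mult_nonneg_nonpos)
      have "0 \<le> \<beta> * x * gam (F x) + gam (F x) powr q"
        using beta_pos x by (intro add_nonneg_nonneg) auto
      then show "drift f F x - \<alpha> * f x - gam (F x) powr q \<le> 0" by (simp add: drift_def)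
    qed simp
    finally show "h' x \<le> 0" .
  qed (use r in auto)
  then show ?thesis using sol_0[OF s] by (simp add: gam_nonpos)
qed

lemma gam_bound:
  obtains C where "0 < C"
    "\<And>a f F r. sol 1 a f F \<Longrightarrow> 0 < a \<Longrightarrow> 0 \<le> r \<Longrightarrow> gam (F r) \<le> C * a powr (2 / p)"
proof
  define c where "c = \<alpha> / 2 * (p / (p - 1))"
  have c: "0 < c" using alpha_pos p1 by (simp add: c_def)
  show "0 < c powr (1 / p)" using c by simp
  fix a r :: real and f F assume s: "sol 1 a f F" and a: "0 < a" and r: "0 \<le> r"
  have "0 \<le> \<alpha> / 2 * (f r)\<^sup>2" using alpha_pos by simp
  then have "(p - 1) / p * gam (F r) powr p \<le> \<alpha> / 2 * a\<^sup>2" using energy[OF s r] by linarith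
  then have "gam (F r) powr p \<le> c * a\<^sup>2" using p1 by (simp add: c_def field_simps)
  then have "(gam (F r) powr p) powr (1 / p) \<le> (c * a\<^sup>2) powr (1 / p)"
    using p1 by (intro powr_mono2) auto
  also have "\<dots> = c powr (1 / p) * a powr (2 / p)"
    using c a by (simp add: powr_mult powr_powr flip: powr_numeral)
  finally show "gam (F r) \<le> c powr (1 / p) * a powr (2 / p)"
    using p1 by (simp add: powr_powr)
qed

lemma f_ge:
  assumes s: "sol k a f F" and st: "0 \<le> s" "s \<le> t" and g: "\<And>r. 0 \<le> r \<Longrightarrow> gam (F r) \<le> c"
  shows "f s - c * (t - s) \<le> f t"
proof -
  have "f s + c * s \<le> f t + c * t"
    by (rule mono_Ici[of "\<lambda>r. f r + c * r" "\<lambda>r. - gam (F r) + c"])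
      (use st g in \<open>auto intro!: derivative_eq_intros sol_f[OF s]\<close>)
  then show ?thesis by (simp add: algebra_simps)
qed

text \<open>Up to an \<open>r\<close> of order \<open>a powr (1 - 2 / p)\<close> the slope bound
  keeps \<open>f\<close> above \<open>a / 2\<close>. At that \<open>r\<close> the curve is of order
  \<open>a powr e\<close> with \<open>e < 0\<close>, which is large for small
  \<open>a\<close>.\<close>

lemma exists_small:
  obtains a where "0 < a" "\<And>f F. sol 1 a f F \<Longrightarrow> \<exists>r>0. K < r powr \<mu> * f r"
proof -
  obtain C where C: "0 < C" and
    gb: "\<And>a f F r. sol 1 a f F \<Longrightarrow> 0 < a \<Longrightarrow> 0 \<le> r \<Longrightarrow> gam (F r) \<le> C * a powr (2 / p)"
    using gam_bound by metis
  define e where "e = (1 - 2 / p) * \<mu> + 1"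
  have e: "e < 0" using mu_p p1 by (simp add: e_def field_simps)
  \<comment> \<open>Chosen so that \<open>B / (2 * C) powr \<mu> / 2\<close> exceeds
    \<open>K\<close>; \<open>a\<close> solves \<open>a powr e = B\<close>.\<close>
  define B where "B = K * (2 * C) powr \<mu> * 2 + 1"
  have B: "0 < B" using K_pos by (simp add: B_def add_nonneg_pos)
  define a where "a = B powr (1 / e)"
  have a: "0 < a" and ae: "a powr e = B" using B e by (auto simp: a_def powr_powr)
  show thesis
  proof (rule that[OF a])
    fix f F assume s: "sol 1 a f F"
    define r where "r = a powr (1 - 2 / p) / (2 * C)"
    have r: "0 < r" using a C by (simp add: r_def)
    have "a powr (2 / p) * a powr (1 - 2 / p) = a" using a by (simp flip: powr_add)
    then have "C * a powr (2 / p) * r = a / 2" using C by (simp add: r_def)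
    then have f: "a / 2 \<le> f r"
      using f_ge[OF s order_refl less_imp_le[OF r] gb[OF s a]] sol_0[OF s] by simp
    have rm: "r powr \<mu> = a powr ((1 - 2 / p) * \<mu>) / (2 * C) powr \<mu>"
      using a C by (simp add: r_def powr_divide powr_powr)
    have "K < B / (2 * C) powr \<mu> / 2"
      using C by (simp add: B_def field_simps)
    also have "\<dots> = r powr \<mu> * (a / 2)"
      using a by (simp add: rm ae[symmetric] e_def powr_add)
    also have "\<dots> \<le> r powr \<mu> * f r" using f by (intro mult_left_mono) auto
    finally show "\<exists>r>0. K < r powr \<mu> * f r" using r by blast
  qed
qed

section \<open>Shooting\<close>

text \<open>If the drift stayed nonnegative, \<open>f\<close> would stay positive. On
  \<open>[0, r1]\<close>, where \<open>f \<ge> a / 2\<close>, flux builds up; for large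
  \<open>a\<close> absorption removes at most half of it before \<open>M * r1\<close>, because
  \<open>2 * q < p\<close>. The resulting slope on \<open>[r1, M * r1]\<close> makes
  \<open>f\<close> fall by \<open>a\<close>, a contradiction.\<close>

lemma exists_large:
  obtains a where "0 < a" "\<And>f F. sol 1 a f F \<Longrightarrow> \<exists>r\<ge>0. drift f F r < 0"
proof -
  obtain C where C: "0 < C" and
    gb: "\<And>a f F r. sol 1 a f F \<Longrightarrow> 0 < a \<Longrightarrow> 0 \<le> r \<Longrightarrow> gam (F r) \<le> C * a powr (2 / p)"
    using gam_bound by metis
  define c where "c = \<alpha> - \<beta>"
  define c1 where "c1 = c / (8 * C)"
  define c2 where "c2 = c1 powr (1 / (p - 1))"
  \<comment> \<open>With slope at least \<open>c2 * a powr (2 / p)\<close>, the interval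
    \<open>[r1, M * r1]\<close> is long enough for a fall by \<open>a\<close>.\<close>
  define M where "M = 1 + 2 * C / c2"
  define e where "e = 1 - 2 * q / p"
  \<comment> \<open>For \<open>a powr e = B\<close> the bound \<open>w\<close> of the absorption
    term satisfies \<open>w * (M * r1) = c * a / 4 * r1\<close>, half of the gain
    \<open>c * a / 2 * r1\<close>.\<close>
  define B where "B = 4 * C powr q * M / c"
  define a where "a = B powr (1 / e)"
  have c: "0 < c" using beta_less_alpha by (simp add: c_def)
  then have c1: "0 < c1" using C by (simp add: c1_def)
  then have c2: "0 < c2" by (simp add: c2_def)
  have M: "1 < M" using C c2 by (simp add: M_def)
  have e: "0 < e" using p1 q2 by (simp add: e_def field_simps)
  have B: "0 < B" using C M c by (simp add: B_def)
  have a: "0 < a" using B by (simp add: a_def)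
  have ae: "a powr e = B" using B e by (simp add: a_def powr_powr)
  define w where "w = c * a / (4 * M)"
  have w: "(C * a powr (2 / p)) powr q = w"
  proof -
    have "a powr (2 * q / p) * a powr e = a" using a by (simp add: e_def flip: powr_add)
    then have "a powr (2 * q / p) * (4 * C powr q * M) = c * a"
      using c unfolding ae B_def by (simp add: field_simps)
    then show ?thesis using M C a by (simp add: w_def powr_mult powr_powr field_simps)
  qed
  show thesis
  proof (rule that[OF a], rule ccontr)
    fix f F assume s: "sol 1 a f F" and "\<not> (\<exists>r\<ge>0. drift f F r < 0)"
    then have E: "0 \<le> drift f F r" if "0 \<le> r" for r using that by force
    have fp: "0 < f r" if "0 \<le> r" for r using sol_pos[OF s a E that] .
    have gq: "gam (F r) powr q \<le> w" if "0 \<le> r" for r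
      using powr_mono2[OF less_imp_le[OF q_pos] _ gb[OF s a that]] by (simp add: w)
    define r1 where "r1 = a powr (1 - 2 / p) / (2 * C)"
    have r1: "0 < r1" using a C by (simp add: r1_def)
    have ar: "a powr (2 / p) * r1 = a / (2 * C)"
      using a by (simp add: r1_def flip: powr_add)
    have f2: "a / 2 \<le> f r" if "r \<le> r1" "0 \<le> r" for r
    proof -
      have "f 0 - C * a powr (2 / p) * (r1 - 0) \<le> f r1"
        by (rule f_ge[OF s _ _ gb[OF s a]]) (use r1 in auto)
      then show ?thesis using ar C sol_0[OF s] sol_antimono[OF s that(2,1)] by (simp add: mult.assoc)
    qed
    \<comment> \<open>In the derivative of \<open>G\<close> the terms
      \<open>\<beta> * r * gam F\<close> cancel, leaving \<open>(\<alpha> - \<beta>) * f\<close>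
      against the absorption; here \<open>\<beta> < \<alpha>\<close> enters.\<close>
    define G where "G = (\<lambda>r. F r - \<beta> * r * f r)"
    have dG: "(G has_real_derivative c * f r - gam (F r) powr q) (at r within {0..})" if "0 \<le> r" for r
      unfolding G_def c_def
      by (rule derivative_eq_intros sol_F[OF s that] sol_f[OF s that] refl | simp add: algebra_simps)+
    have "G 0 - (c * a / 2 - w) * 0 \<le> G r1 - (c * a / 2 - w) * r1"
    proof (rule mono_Ici[of "\<lambda>r. G r - (c * a / 2 - w) * r"
          "\<lambda>r. c * f r - gam (F r) powr q - (c * a / 2 - w)"])
      show "0 \<le> c * f r - gam (F r) powr q - (c * a / 2 - w)" if "0 < r" "r < r1" for r
      proof -
        have "c * (a / 2) \<le> c * f r" using f2[of r] that c by simp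
        then show ?thesis using gq[of r] that by simp
      qed
    qed (use r1 in \<open>auto intro!: derivative_eq_intros dG\<close>)
    then have G1: "(c * a / 2 - w) * r1 \<le> G r1" using sol_0[OF s] by (simp add: G_def)
    have g: "c2 * a powr (2 / p) \<le> gam (F r)" if r: "r1 \<le> r" "r \<le> M * r1" for r
    proof -
      have "G r1 + w * r1 \<le> G r + w * r"
      proof (rule mono_Ici[of "\<lambda>r. G r + w * r" "\<lambda>r. c * f r - gam (F r) powr q + w"])
        show "0 \<le> c * f x - gam (F x) powr q + w" if "r1 < x" "x < r" for x
        proof -
          have "0 \<le> c * f x" using c fp[of x] that r1 by simp
          then show ?thesis using gq[of x] that r1 by simp
        qed
      qed (use r1 r in \<open>auto intro!: derivative_eq_intros dG\<close>)
      then have "c * a / 2 * r1 - w * r \<le> G r" using G1 by (simp add: algebra_simps)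
      moreover have "w * r \<le> w * (M * r1)" using r c a M by (intro mult_left_mono) (auto simp: w_def)
      moreover have "w * (M * r1) = c * a / 4 * r1" using M by (simp add: w_def)
      ultimately have "c * a / 4 * r1 \<le> G r" by simp
      also have "\<dots> \<le> F r" using beta_pos fp[of r] r r1 by (simp add: G_def)
      finally have "c * a / 4 * r1 \<le> F r" .
      moreover have "c * a / 4 * r1 = c1 * (a powr (2 / p)) powr (p - 1)"
      proof -
        have "a * a powr (1 - 2 / p) = a powr (2 / p * (p - 1))"
          using a p1 powr_add[of a 1 "1 - 2 / p"] by (simp add: right_diff_distrib)
        then show ?thesis using C by (simp add: r1_def c1_def powr_powr)
      qed
      ultimately have "gam (c1 * (a powr (2 / p)) powr (p - 1)) \<le> gam (F r)"
        by (intro gam_mono) simp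
      moreover have "gam (c1 * b powr (p - 1)) = c2 * b" if "0 < b" for b
        using c1 p1 that by (simp add: gam_def c2_def powr_mult powr_powr)
      ultimately show ?thesis using a by simp
    qed
    have "f (M * r1) + c2 * a powr (2 / p) * (M * r1) \<le> f r1 + c2 * a powr (2 / p) * r1"
    proof (rule antimono_Ici[of "\<lambda>r. f r + c2 * a powr (2 / p) * r"
          "\<lambda>r. - gam (F r) + c2 * a powr (2 / p)"])
      show "- gam (F r) + c2 * a powr (2 / p) \<le> 0" if "r1 < r" "r < M * r1" for r
        using g[of r] that by simp
    qed (use r1 M in \<open>auto intro!: derivative_eq_intros sol_f[OF s]\<close>)
    moreover have "c2 * a powr (2 / p) * (M * r1) = c2 * a powr (2 / p) * r1 + a"
    proof -
      have "c2 * a powr (2 / p) * (M * r1) = c2 * M * (a powr (2 / p) * r1)" by simp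
      also have "\<dots> = c2 * (a powr (2 / p) * r1) + a"
        unfolding ar M_def using C c2 by (simp add: field_simps)
      finally show ?thesis by simp
    qed
    ultimately show False using fp[of "M * r1"] r1 M sol_le[OF s, of r1] by simp
  qed
qed

text \<open>This makes the two sets of the shooting argument disjoint. Negative drift up to time
  \<open>r\<close> would leave the curve below \<open>K\<close> at \<open>r\<close>. After
  \<open>r\<close> the curve does not decrease as long as it is above \<open>K\<close>, so it stays
  there, and negative drift is impossible.\<close>

lemma Y_gt_K_imp_drift_nonneg:
  assumes s: "sol k a f F" and k: "0 < k" and a: "0 < a"
    and r: "0 < r" "K < r powr \<mu> * f r" and t: "0 \<le> t"
  shows "0 \<le> drift f F t"
proof (rule ccontr)
  assume "\<not> ?thesis"
  then have n: "drift f F t < 0" by simp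
  have f: "0 < f u" if "K \<le> u powr \<mu> * f u" "0 < u" for u
    using that K_pos zero_less_mult_pos[of "u powr \<mu>" "f u"] by simp
  show False
  proof (cases "t \<le> r")
    case True
    then show False using drift_neg_persists(2)[OF s k a t n True f] r by simp
  next
    case False
    have "0 < t powr \<mu> * f t - K"
    proof (rule pos_persists[of r t "\<lambda>t. t powr \<mu> * f t - K"])
      show "continuous_on {r..t} (\<lambda>t. t powr \<mu> * f t - K)"
        using r by (intro continuous_intros continuous_on_subset[OF sol_cont(1)[OF s]]) auto
      fix u assume u: "r < u" "u \<le> t" "u powr \<mu> * f u - K = 0"
        and pos: "\<And>s. r \<le> s \<Longrightarrow> s < u \<Longrightarrow> 0 < s powr \<mu> * f s - K"
      have "r powr \<mu> * f r \<le> u powr \<mu> * f u"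
      proof (rule Y_mono[OF s r(1)])
        fix x assume x: "r < x" "x < u"
        then show "0 \<le> drift f F x"
          using drift_neg_persists(2)[OF s k a, of x x] pos[of x] f[of x] r by force
      qed (use u in simp)
      \<comment> \<open>No such \<open>u\<close> exists: the curve at \<open>u\<close> is at least
        its value at \<open>r\<close>, which exceeds \<open>K\<close>.\<close>
      then show "\<exists>d>0. ((\<lambda>t. t powr \<mu> * f t - K) has_real_derivative d) (at u)" using u r by simp
    qed (use r False in auto)
    then show False using drift_neg_persists(2)[OF s k a t n order_refl] f[of t] False r by simp
  qed
qed

lemma critical_exists:
  obtains a f F where "0 < a" "sol 1 a f F" "critical f F"
proof -
  have "\<exists>f F. 0 < a \<longrightarrow> sol 1 a f F" for a using sol_exists[of 1 a] by (cases "0 < a") auto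
  then obtain ff FF where sol: "\<And>a. 0 < a \<Longrightarrow> sol 1 a (ff a) (FF a)" by metis
  \<comment> \<open>At a fixed time the flow is locally Lipschitz in the starting value, which makes
    \<open>A\<close> and \<open>B\<close> below open.\<close>
  have cont: "continuous_on {0<..} (\<lambda>a. ff a r) \<and> continuous_on {0<..} (\<lambda>a. FF a r)"
    if r: "0 \<le> r" for r
  proof -
    have "((\<lambda>b. ff b r) \<longlongrightarrow> ff a r) (at a within {0<..}) \<and>
        ((\<lambda>b. FF b r) \<longlongrightarrow> FF a r) (at a within {0<..})" if a: "0 < a" for a
    proof -
      obtain C where C: "\<And>b c f F g G. 0 \<le> b \<Longrightarrow> b \<le> a + 1 \<Longrightarrow> 0 \<le> c \<Longrightarrow> c \<le> a + 1 \<Longrightarrow>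
          sol 1 b f F \<Longrightarrow> sol 1 c g G \<Longrightarrow> (f r - g r)\<^sup>2 + (F r - G r)\<^sup>2 \<le> C * (b - c)\<^sup>2"
        using sol_continuous_dependence[of 1 "a + 1" r] a r by force
      have ev: "\<forall>\<^sub>F b in at a within {0<..}. 0 < b \<and> b < a + 1"
        using a by (auto simp: eventually_at intro!: exI[of _ 1] simp: dist_real_def)
      have le: "\<bar>ff b r - ff a r\<bar> \<le> sqrt C * \<bar>b - a\<bar> \<and> \<bar>FF b r - FF a r\<bar> \<le> sqrt C * \<bar>b - a\<bar>"
        if b: "0 < b \<and> b < a + 1" for b
      proof -
        have *: "(ff b r - ff a r)\<^sup>2 + (FF b r - FF a r)\<^sup>2 \<le> C * (b - a)\<^sup>2"
          using C[OF _ _ _ _ sol sol, of b a] a b by simp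
        have "(ff b r - ff a r)\<^sup>2 \<le> C * (b - a)\<^sup>2" "(FF b r - FF a r)\<^sup>2 \<le> C * (b - a)\<^sup>2"
          using * zero_le_power2[of "FF b r - FF a r"] zero_le_power2[of "ff b r - ff a r"] by linarith+
        from this[THEN real_sqrt_le_mono] show ?thesis by (simp add: real_sqrt_mult)
      qed
      have lim: "((\<lambda>b. sqrt C * \<bar>b - a\<bar>) \<longlongrightarrow> 0) (at a within {0<..})"
        by (auto intro!: tendsto_eq_intros)
      have "((\<lambda>b. ff b r - ff a r) \<longlongrightarrow> 0) (at a within {0<..})"
        by (rule Lim_null_comparison[OF _ lim], rule eventually_mono[OF ev]) (use le in auto)
      moreover have "((\<lambda>b. FF b r - FF a r) \<longlongrightarrow> 0) (at a within {0<..})"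
        by (rule Lim_null_comparison[OF _ lim], rule eventually_mono[OF ev]) (use le in auto)
      ultimately show ?thesis by (simp add: LIM_zero_iff)
    qed
    then show ?thesis by (auto simp: continuous_on_def)
  qed
  define A where "A = (\<Union>r\<in>{0..}. {0<..} \<inter> (\<lambda>a. drift (ff a) (FF a) r) -` {..<0})"
  define B where "B = (\<Union>r\<in>{0<..}. {0<..} \<inter> (\<lambda>a. r powr \<mu> * ff a r) -` {K<..})"
  have "continuous_on {0<..} (\<lambda>a. drift (ff a) (FF a) r)" if "0 \<le> r" for r
    unfolding drift_def using cont[OF that] by (intro continuous_intros continuous_on_gam) auto
  then have "open A" unfolding A_def
    by (intro open_UN ballI continuous_open_preimage) auto
  moreover have "open B" unfolding B_def using cont
    by (intro open_UN ballI continuous_open_preimage continuous_intros) auto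
  moreover have "A \<inter> B \<inter> {0<..} = {}"
    using Y_gt_K_imp_drift_nonneg[OF sol] by (force simp: A_def B_def)
  moreover have "A \<inter> {0<..} \<noteq> {}"
  proof -
    obtain a where a: "0 < a" "\<And>f F. sol 1 a f F \<Longrightarrow> \<exists>r\<ge>0. drift f F r < 0"
      using exists_large by blast
    then have "a \<in> A" using a(2)[OF sol[OF a(1)]] by (auto simp: A_def)
    then show ?thesis using a(1) by blast
  qed
  moreover have "B \<inter> {0<..} \<noteq> {}"
  proof -
    obtain a where a: "0 < a" "\<And>f F. sol 1 a f F \<Longrightarrow> \<exists>r>0. K < r powr \<mu> * f r"
      using exists_small by blast
    then have "a \<in> B" using a(2)[OF sol[OF a(1)]] by (auto simp: B_def)
    then show ?thesis using a(1) by blast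
  qed
  ultimately have "\<not> {0<..} \<subseteq> A \<union> B"
    using connectedD[of "{0::real<..}" A B] by auto
  then obtain a where "0 < a" "a \<notin> A" "a \<notin> B" by auto
  then have "critical (ff a) (FF a)"
    by (force simp: A_def B_def critical_def not_less)
  then show thesis using that sol \<open>0 < a\<close> by blast
qed

section \<open>Passage between the first order system and the original equation\<close>

lemma abs_flux: "\<bar>flux p s\<bar> = \<bar>s\<bar> powr (p - 1)"
  using powr_add[of "\<bar>s\<bar>" "p - 2" 1] by (cases "s = 0") (auto simp: flux_def abs_mult)

lemma flux_gam: "0 \<le> x \<Longrightarrow> flux p (- gam x) = - x"
  using abs_flux[of "- gam x"] gam_powr_p1[of x] by (simp add: flux_def abs_mult)

lemma gam_flux: "s \<le> 0 \<Longrightarrow> gam (- flux p s) = - s"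
proof -
  assume s: "s \<le> 0"
  then have "flux p s \<le> 0" by (simp add: flux_def mult_nonneg_nonpos)
  then have "max 0 (- flux p s) = (- s) powr (p - 1)" using abs_flux[of s] s by simp
  then show ?thesis using s p1 by (simp add: gam_def powr_powr)
qed

lemma sol_global_solution:
  assumes s: "sol 1 a f F" and F: "\<And>r. 0 < r \<Longrightarrow> 0 < F r"
  shows "global_solution p q a f"
proof -
  let ?d = "\<lambda>r. - (\<alpha> * f r - \<beta> * r * gam (F r) - gam (F r) powr q)"
  have F0: "0 \<le> F r" if "0 \<le> r" for r
    using F[of r] sol_0[OF s] that by (cases "r = 0") auto
  have "((\<lambda>s. flux p (- gam (F s))) has_real_derivative ?d r) (at r within {0..})" if "0 \<le> r" for r
  proof (rule has_field_derivative_transform_within[where d = 1])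
    show "((\<lambda>s. - F s) has_real_derivative ?d r) (at r within {0..})"
      using DERIV_minus[OF sol_F[OF s that]] by simp
  qed (use that flux_gam F0 in auto)
  moreover have "continuous_on {0..} ?d"
    using sol_cont[OF s] q_pos by (intro continuous_intros continuous_on_powr') auto
  ultimately show ?thesis
    unfolding global_solution_def using sol_f[OF s] sol_cont[OF s] sol_0[OF s]
    by (intro exI[of _ "\<lambda>r. - gam (F r)"] exI[of _ ?d])
      (auto simp: gam_nonpos intro!: continuous_intros)
qed

text \<open>Where \<open>f'\<close> vanishes, the equation gives
  \<open>F' = \<alpha> * f > 0\<close>, so \<open>F\<close> is positive after \<open>0\<close>.
  Hence \<open>f' \<le> 0\<close>, the range on which \<open>gam\<close> inverts the flux.\<close>

lemma global_solution_sol: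
  assumes g: "global_solution p q a f" and a: "0 < a" and f: "\<And>r. 0 < r \<Longrightarrow> 0 < f r"
  obtains F where "sol 1 a f F"
proof -
  obtain f1 d where f1: "\<And>r. 0 \<le> r \<Longrightarrow> (f has_real_derivative f1 r) (at r within {0..})"
    and c1: "continuous_on {0..} f1"
    and d: "\<And>r. 0 \<le> r \<Longrightarrow> ((\<lambda>s. flux p (f1 s)) has_real_derivative d r) (at r within {0..})"
    and cd: "continuous_on {0..} d"
    and ode: "\<And>r. 0 < r \<Longrightarrow> d r + \<alpha> * f r + \<beta> * r * f1 r - \<bar>f1 r\<bar> powr q = 0"
    and i: "f 0 = a" "f1 0 = 0"
    using g unfolding global_solution_def by auto
  \<comment> \<open>The equation is given for \<open>r > 0\<close> only; continuity carries it to
    \<open>0\<close>, where \<open>sol\<close> asks for it too.\<close>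
  have ode0: "d r + \<alpha> * f r + \<beta> * r * f1 r - \<bar>f1 r\<bar> powr q = 0" if "0 \<le> r" for r
  proof (rule continuous_constant_on_closure[of "{0<..}" "\<lambda>r. d r + \<alpha> * f r + \<beta> * r * f1 r - \<bar>f1 r\<bar> powr q"])
    have "continuous_on {0..} f" by (intro DERIV_continuous_on[of _ _ f1] f1) auto
    moreover have "continuous_on {0..} (\<lambda>r. \<bar>f1 r\<bar> powr q)"
      by (rule continuous_on_powr') (use q_pos c1 in \<open>auto intro!: continuous_intros\<close>)
    ultimately show "continuous_on (closure {0<..}) (\<lambda>r. d r + \<alpha> * f r + \<beta> * r * f1 r - \<bar>f1 r\<bar> powr q)"
      using c1 cd by (auto intro!: continuous_intros)
  qed (use ode that in auto)
  define F where "F = (\<lambda>r. - flux p (f1 r))"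
  have dF: "(F has_real_derivative - d r) (at r within {0..})" if "0 \<le> r" for r
    unfolding F_def using d[OF that] by (rule DERIV_minus)
  have F0: "F 0 = 0" by (simp add: F_def i flux_def)
  have Fp: "0 < F r" if "0 < r" for r
  proof (rule pos_of_DERIV_pos_at_zeros[OF dF F0 that])
    fix r assume r: "0 \<le> r" "F r = 0"
    then have "f1 r = 0" using abs_flux[of "f1 r"] by (simp add: F_def)
    moreover have "0 < \<alpha> * f r" using f[of r] r a i alpha_pos by (cases "r = 0") auto
    ultimately show "0 < - d r" using ode0[OF r(1)] by simp
  qed
  have "f1 r \<le> 0" if "0 \<le> r" for r
  proof (cases "r = 0")
    case False
    then have "flux p (f1 r) < 0" using Fp[of r] that by (simp add: F_def)
    then show ?thesis by (auto simp: flux_def mult_less_0_iff)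
  qed (use i in simp)
  then have f1g: "f1 r = - gam (F r)" if "0 \<le> r" for r
    using gam_flux[of "f1 r"] that by (simp add: F_def)
  have "sol 1 a f F" unfolding sol_def
  proof (intro conjI allI impI)
    fix r :: real assume r: "0 \<le> r"
    show "(f has_real_derivative - gam (F r)) (at r within {0..})" using f1[OF r] f1g[OF r] by simp
    have "1 * (\<alpha> * f r - \<beta> * r * gam (F r)) - gam (F r) powr q = - d r"
      using ode0[OF r] f1g[OF r] by simp
    then show "(F has_real_derivative 1 * (\<alpha> * f r - \<beta> * r * gam (F r)) - gam (F r) powr q)
        (at r within {0..})" using dF[OF r] by simp
  qed (use i F0 in auto)
  then show thesis by (rule that)
qed

text \<open>By \<open>mu_q\<close>, diffusion and absorption both pick up
  \<open>l powr (q * (\<mu> + 1))\<close>, whereas the drift picks up \<open>l powr \<mu>\<close>;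
  the quotient is the new factor. The curve \<open>r powr \<mu> * f r\<close> is only reparametrised
  and the sign of the drift is kept, so criticality survives.\<close>

lemma sol_scale:
  assumes s: "sol 1 a f F" and l: "0 < l"
  shows "sol (l powr (q * (\<mu> + 1) - \<mu>)) (l powr \<mu> * a)
    (\<lambda>r. l powr \<mu> * f (l * r)) (\<lambda>r. l powr ((\<mu> + 1) * (p - 1)) * F (l * r))"
    (is "sol ?k _ ?f ?F")
    and "critical f F \<Longrightarrow> critical (\<lambda>r. l powr \<mu> * f (l * r)) (\<lambda>r. l powr ((\<mu> + 1) * (p - 1)) * F (l * r))"
proof -
  have g: "gam (?F r) = l powr (\<mu> + 1) * gam (F (l * r))" for r
  proof -
    have "max 0 (?F r) = l powr ((\<mu> + 1) * (p - 1)) * max 0 (F (l * r))"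
      using l by (simp add: max_def zero_le_mult_iff not_le mult_less_0_iff)
    then show ?thesis using p1 by (simp add: gam_def powr_mult powr_powr)
  qed
  have scale: "((\<lambda>x. h (l * x)) has_real_derivative d * l) (at r within {0..})"
    if "(h has_real_derivative d) (at (l * r) within {0..})" for h d r
  proof -
    have "((*) l has_real_derivative l) (at r within {0..})"
      using DERIV_cmult_Id by blast
    moreover have "(*) l ` {0..} \<subseteq> {0..}" using l by auto
    ultimately show ?thesis
      using DERIV_image_chain[of h d "(*) l" r "{0..}" l] that DERIV_subset[of h d "l * r" "{0..}"]
      by (simp add: o_def)
  qed
  show "sol ?k (l powr \<mu> * a) ?f ?F"
    unfolding sol_def
  proof (intro conjI allI impI)
    fix r :: real assume r: "0 \<le> r"
    then have lr: "0 \<le> l * r" using l by simp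
    show "(?f has_real_derivative - gam (?F r)) (at r within {0..})"
    proof (rule DERIV_cong[OF DERIV_cmult[OF scale[OF sol_f[OF s lr]], of "l powr \<mu>"]])
      show "l powr \<mu> * (- gam (F (l * r)) * l) = - gam (?F r)"
        unfolding g using l by (simp add: powr_add)
    qed
    let ?n = "(\<mu> + 1) * (p - 1)"
    have n: "l powr ?n * l = l powr (q * (\<mu> + 1))"
      using mu_q l powr_add[of l ?n 1] by (simp add: mult.commute)
    have "?k * (\<alpha> * ?f r - \<beta> * r * gam (?F r)) - gam (?F r) powr q =
      l powr ?n * l * (\<alpha> * f (l * r) - \<beta> * (l * r) * gam (F (l * r)) - gam (F (l * r)) powr q)"
    proof -
      have 1: "?k * l powr \<mu> = l powr (q * (\<mu> + 1))" by (simp flip: powr_add)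
      then have 2: "?k * l powr (\<mu> + 1) = l powr (q * (\<mu> + 1)) * l"
        using l by (simp add: powr_add flip: mult.assoc)
      have 3: "(l powr (\<mu> + 1) * y) powr q = l powr (q * (\<mu> + 1)) * y powr q" for y
        by (simp add: powr_mult powr_powr mult.commute[of q])
      have "w * (\<alpha> * (u * x) - \<beta> * r * (v * y)) - z * t = z * (\<alpha> * x - \<beta> * (l * r) * y - t)"
        if "w * u = z" "w * v = z * l" for w u v x y z t
      proof -
        have "w * (\<alpha> * (u * x) - \<beta> * r * (v * y)) = \<alpha> * (w * u) * x - \<beta> * r * (w * v) * y"
          by (simp add: algebra_simps)
        then show ?thesis unfolding that by (simp add: algebra_simps)
      qed
      from this[OF 1 2] show ?thesis unfolding n g 3 .
    qed
    then show "(?F has_real_derivative ?k * (\<alpha> * ?f r - \<beta> * r * gam (?F r)) - gam (?F r) powr q)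
        (at r within {0..})"
      using DERIV_cmult[OF scale[OF sol_F[OF s lr]], of "l powr ?n"] by (simp add: mult_ac)
  qed (use sol_0[OF s] in auto)
  show "critical ?f ?F" if c: "critical f F"
  proof -
    have "drift ?f ?F r = l powr \<mu> * drift f F (l * r)" for r
      unfolding drift_def g using l by (simp add: powr_add right_diff_distrib)
    moreover have "r powr \<mu> * ?f r \<le> K" if "0 < r" for r
    proof -
      have "r powr \<mu> * ?f r = (l * r) powr \<mu> * f (l * r)" by (simp add: powr_mult)
      also have "\<dots> \<le> K" using c l that by (auto simp: critical_def)
      finally show ?thesis .
    qed
    ultimately show ?thesis using c l unfolding critical_def by simp
  qed
qed

lemma asymp_equiv_iff:
  "f \<sim>[at_top] (\<lambda>r. K * r powr (- \<mu>)) \<longleftrightarrow> ((\<lambda>r. r powr \<mu> * f r) \<longlongrightarrow> K) at_top"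
proof -
  have ev: "\<forall>\<^sub>F r in at_top. f r / (K * r powr (- \<mu>)) = r powr \<mu> * f r / K"
    using eventually_gt_at_top[of 0] by eventually_elim (simp add: powr_minus field_simps)
  have "f \<sim>[at_top] (\<lambda>r. K * r powr (- \<mu>)) \<longleftrightarrow> ((\<lambda>r. f r / (K * r powr (- \<mu>))) \<longlongrightarrow> 1) at_top"
  proof
    assume a: "f \<sim>[at_top] (\<lambda>r. K * r powr (- \<mu>))"
    show "((\<lambda>r. f r / (K * r powr (- \<mu>))) \<longlongrightarrow> 1) at_top"
      by (rule asymp_equivD_strong[OF a], rule eventually_mono[OF eventually_gt_at_top[of 0]])
        (use K_pos in auto)
  qed (rule asymp_equivI')
  also have "\<dots> \<longleftrightarrow> ((\<lambda>r. r powr \<mu> * f r / K) \<longlongrightarrow> 1) at_top"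
    by (rule tendsto_cong[OF ev])
  also have "\<dots> \<longleftrightarrow> ((\<lambda>r. r powr \<mu> * f r) \<longlongrightarrow> K) at_top"
  proof
    assume "((\<lambda>r. r powr \<mu> * f r / K) \<longlongrightarrow> 1) at_top"
    from tendsto_mult_left[OF this, of K] show "((\<lambda>r. r powr \<mu> * f r) \<longlongrightarrow> K) at_top"
      using K_pos by simp
  next
    assume "((\<lambda>r. r powr \<mu> * f r) \<longlongrightarrow> K) at_top"
    from tendsto_divide[OF this tendsto_const[of K]] show "((\<lambda>r. r powr \<mu> * f r / K) \<longlongrightarrow> 1) at_top"
      using K_pos by simp
  qed
  finally show ?thesis .
qed

section \<open>Uniqueness\<close>

text \<open>With \<open>\<phi>\<close> strictly decreasing, \<open>\<rho>\<close> is the time at which \<open>\<phi>\<close> takes the value that \<open>f\<close> has at \<open>r\<close>.\<close>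

lemma level_time:
  assumes s: "sol 1 a f F" and a: "0 < a" and c: "critical f F"
    and t: "sol k a \<phi> \<Phi>" and k: "0 < k" and c': "critical \<phi> \<Phi>"
  obtains \<rho> where "\<And>r. 0 < r \<Longrightarrow> 0 < \<rho> r" "\<And>r. 0 < r \<Longrightarrow> \<phi> (\<rho> r) = f r"
    "\<And>r. 0 < r \<Longrightarrow> (\<rho> has_real_derivative gam (F r) / gam (\<Phi> (\<rho> r))) (at r)"
proof -
  have Fp: "0 < F r" "0 < \<Phi> r" if "0 < r" for r
    using critical_F_pos[OF s _ a c that] critical_F_pos[OF t k a c' that] by auto
  have dec: "h u < h v" if "sol j a h H" "\<And>r. 0 < r \<Longrightarrow> 0 < H r" "0 \<le> v" "v < u" for j h H u v
  proof (rule DERIV_neg_imp_decreasing_open[OF that(4)])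
    show "\<exists>y. (h has_real_derivative y) (at x) \<and> y < 0" if "v < x" "x < u" for x
      using sol_f_at[OF \<open>sol j a h H\<close>, of x] \<open>\<And>r. 0 < r \<Longrightarrow> 0 < H r\<close>[of x] \<open>0 \<le> v\<close> that
      by (auto simp: gam_pos intro!: exI[of _ "- gam (H x)"])
    show "continuous_on {v..u} h"
      by (rule continuous_on_subset[OF sol_cont(1)[OF that(1)]]) (use that in auto)
  qed
  have inj: "inj_on \<phi> {0..}"
    by (rule linorder_inj_onI') (use dec[OF t Fp(2)] in force)
  define \<psi> where "\<psi> = the_inv_into {0..} \<phi>"
  have \<psi>: "\<psi> (\<phi> x) = x" if "0 \<le> x" for x
    unfolding \<psi>_def using the_inv_into_f_f[OF inj] that by simp
  have ex: "\<exists>x>0. \<phi> x = f r" if r: "0 < r" for r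
  proof -
    have f: "0 < f r" "f r < a"
      using sol_pos[OF s a, of r] c dec[OF s Fp(1), of 0 r] sol_0[OF s] r by (auto simp: critical_def)
    \<comment> \<open>The time at which \<open>K * r powr (- \<mu>)\<close> has come down to
      \<open>f r\<close>. As \<open>\<phi>\<close> lies on or below that curve, it has reached the
      value \<open>f r\<close> by then.\<close>
    define T where "T = (K / f r) powr (1 / \<mu>)"
    have T: "0 < T" "T powr \<mu> = K / f r" using K_pos f mu_pos by (auto simp: T_def powr_powr)
    have "T powr \<mu> * \<phi> T \<le> K" using c' T by (auto simp: critical_def)
    then have "\<phi> T \<le> f r" using T f K_pos by (simp add: field_simps)
    moreover have "continuous_on {0..T} \<phi>"
      by (rule continuous_on_subset[OF sol_cont(1)[OF t]]) auto
    ultimately obtain x where "0 \<le> x" "\<phi> x = f r"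
      using IVT2'[of \<phi> T "f r" 0] sol_0[OF t] f T by auto
    then show ?thesis using sol_0[OF t] f by (intro exI[of _ x]) (cases "x = 0", auto)
  qed
  define \<rho> where "\<rho> = (\<lambda>r. \<psi> (f r))"
  have \<rho>: "0 < \<rho> r" "\<phi> (\<rho> r) = f r" if r: "0 < r" for r
    using ex[OF r] \<psi> by (auto simp: \<rho>_def) (metis less_imp_le)+
  have "(\<rho> has_real_derivative gam (F r) / gam (\<Phi> (\<rho> r))) (at r)" if r: "0 < r" for r
  proof -
    let ?x = "\<rho> r"
    have g: "0 < gam (\<Phi> ?x)" using Fp(2)[OF \<rho>(1)[OF r]] by (simp add: gam_pos)
    have "(\<psi> has_derivative (*) (inverse (- gam (\<Phi> ?x)))) (at (\<phi> ?x))"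
    proof (rule has_derivative_inverse_strong[where S = "{0<..}" and f = \<phi> and x = ?x
          and f' = "(*) (- gam (\<Phi> ?x))"])
      show "(\<phi> has_derivative (*) (- gam (\<Phi> ?x))) (at ?x)"
        using sol_f_at[OF t \<rho>(1)[OF r]] by (simp add: has_field_derivative_def)
      show "continuous_on {0<..} \<phi>" by (rule continuous_on_subset[OF sol_cont(1)[OF t]]) auto
      show "(*) (- gam (\<Phi> ?x)) \<circ> (*) (inverse (- gam (\<Phi> ?x))) = id" using g by (auto simp: fun_eq_iff)
    qed (use \<rho>(1)[OF r] \<psi> in auto)
    then have "(\<psi> has_real_derivative inverse (- gam (\<Phi> ?x))) (at (f r))"
      using \<rho>(2)[OF r] by (simp add: has_field_derivative_def)
    from DERIV_chain2[OF this sol_f_at[OF s r]] show ?thesis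
      by (simp add: \<rho>_def divide_inverse mult.commute)
  qed
  with \<rho> show thesis using that by blast
qed

text \<open>Where \<open>f\<close> and \<open>\<phi>\<close> have fallen to the same value, \<open>f\<close> has the larger flux, because in \<open>f\<close> the
  driving term \<open>drift\<close> enters with the larger factor. The gap \<open>D\<close> between the fluxes satisfies
  \<open>D' \<ge> - c r\<^sup>-\<^sup>1\<^sup>-\<^sup>\<sigma> D\<close> with \<open>\<sigma> = \<mu> - q (\<mu> + 1) > 0\<close>, so it cannot tend to \<open>0\<close>, whereas both fluxes do.\<close>

lemma critical_factor_contradiction:
  assumes s: "sol 1 a f F" and a: "0 < a" and c: "critical f F"
    and t: "sol k a \<phi> \<Phi>" and k: "0 < k" "k < 1" and c': "critical \<phi> \<Phi>"
  shows False
proof -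
  obtain \<rho> where \<rho>: "\<And>r. 0 < r \<Longrightarrow> 0 < \<rho> r" "\<And>r. 0 < r \<Longrightarrow> \<phi> (\<rho> r) = f r"
    and d\<rho>: "\<And>r. 0 < r \<Longrightarrow> (\<rho> has_real_derivative gam (F r) / gam (\<Phi> (\<rho> r))) (at r)"
    using level_time[OF s a c t k(1) c'] by blast
  have Fp: "0 < F r" "0 < \<Phi> r" if "0 < r" for r
    using critical_F_pos[OF s _ a c that] critical_F_pos[OF t k(1) a c' that] by auto
  have E: "0 \<le> drift f F r" "0 \<le> drift \<phi> \<Phi> r" if "0 \<le> r" for r
    using c c' that by (auto simp: critical_def)
  have fp: "0 < f r" if "0 \<le> r" for r
    using sol_pos[OF s a E(1) that] .
  define G where "G = (\<lambda>r. gam (F r))"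
  define H where "H = (\<lambda>r. gam (\<Phi> (\<rho> r)))"
  have GH: "0 < G r" "0 < H r" if "0 < r" for r
    using Fp \<rho>(1) that by (auto simp: G_def H_def gam_pos)
  define D where "D = (\<lambda>r. F r - \<Phi> (\<rho> r))"
  \<comment> \<open>The derivative of the gap sorted by sign: for \<open>k < 1\<close>,
    \<open>D r \<ge> 0\<close> and \<open>\<rho> r > r\<close>, only the third summand can lower the
    gap. The last one is then nonnegative because \<open>q < 1\<close>.\<close>
  define D' where "D' = (\<lambda>r. (1 - k) * drift f F r + k * \<beta> * (\<rho> r - r) * G r
    - k * \<alpha> * f r * ((G r - H r) / H r) + (G r * (H r powr q / H r) - G r powr q))"
  have dD: "(D has_real_derivative D' r) (at r)" if r: "0 < r" for r
  proof -
    have "(D has_real_derivative (1 * drift f F r - G r powr q) -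
        (k * drift \<phi> \<Phi> (\<rho> r) - H r powr q) * (G r / H r)) (at r)"
      unfolding D_def G_def H_def
      by (rule DERIV_diff[OF DERIV_F[OF s r] DERIV_chain2[OF DERIV_F[OF t \<rho>(1)[OF r]] d\<rho>[OF r]]])
    moreover have "(1 * drift f F r - G r powr q) - (k * drift \<phi> \<Phi> (\<rho> r) - H r powr q) * (G r / H r) = D' r"
    proof -
      have *: "(1 * e - u) - (k * (\<alpha> * x - \<beta> * z * h) - v) * (g / h) =
          (1 - k) * e + k * \<beta> * (z - r) * g - k * \<alpha> * x * ((g - h) / h) + (g * (v / h) - u)"
        if "0 < h" "e = \<alpha> * x - \<beta> * r * g" for e u v x z g h
        using that(1) unfolding that(2) by (simp add: field_simps)
      have 1: "drift \<phi> \<Phi> (\<rho> r) = \<alpha> * f r - \<beta> * \<rho> r * H r"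
        using \<rho>(2)[OF r] by (simp add: drift_def H_def)
      have 2: "drift f F r = \<alpha> * f r - \<beta> * r * G r" by (simp add: drift_def G_def)
      show ?thesis unfolding D'_def 1 by (rule *[OF GH(2)[OF r] 2])
    qed
    ultimately show ?thesis by (rule DERIV_cong)
  qed
  have D'_ge: "k * \<beta> * (\<rho> r - r) * G r - k * \<alpha> * f r * ((G r - H r) / H r) \<le> D' r"
    if r: "0 < r" "0 \<le> D r" for r
  proof -
    have HG: "H r \<le> G r" using r by (simp add: G_def H_def D_def gam_mono)
    have "G r powr (q - 1) \<le> H r powr (q - 1)"
      using HG GH(2)[OF r(1)] q_lt1 by (intro powr_mono2') auto
    then have "G r * (G r powr q / G r) \<le> G r * (H r powr q / H r)"
      using GH[OF r(1)] by (intro mult_left_mono) (auto simp: powr_diff)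
    then have "0 \<le> G r * (H r powr q / H r) - G r powr q" using GH(1)[OF r(1)] by simp
    moreover have "0 \<le> (1 - k) * drift f F r" using k E[of r] r by simp
    ultimately show ?thesis unfolding D'_def by linarith
  qed

  \<comment> \<open>Positivity of the gap\<close>
  have \<rho>_gt: "r < \<rho> r" if r: "0 < r" and pos: "\<And>x. 0 < x \<Longrightarrow> x < r \<Longrightarrow> 0 < D x" for r
  proof -
    have d: "((\<lambda>x. \<rho> x - x) has_real_derivative G x / H x - 1) (at x)" if "0 < x" for x
      using DERIV_diff[OF d\<rho>[OF that] DERIV_ident] by (simp add: G_def H_def)
    have gt: "0 < G x / H x - 1" if "0 < x" "x < r" for x
      using pos[OF that] gam_less[of "\<Phi> (\<rho> x)" "F x"] Fp(2)[OF \<rho>(1)[OF that(1)]] GH(2)[OF that(1)]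
      by (simp add: D_def G_def H_def)
    \<comment> \<open>\<open>\<rho> x - x\<close> is nondecreasing and greater than
      \<open>- x\<close>; taking \<open>x\<close> arbitrarily small makes it nonnegative at
      \<open>r / 2\<close>.\<close>
    have "r / 2 \<le> \<rho> (r / 2)"
    proof (rule field_le_epsilon)
      fix e :: real assume e: "0 < e"
      define x where "x = min e (r / 2)"
      have x: "0 < x" "x \<le> r / 2" "x \<le> e" using e r by (auto simp: x_def)
      have "\<rho> x - x \<le> \<rho> (r / 2) - r / 2"
        by (rule mono_pos[OF d]) (use gt x r in \<open>auto intro: less_imp_le\<close>)
      then show "r / 2 \<le> \<rho> (r / 2) + e" using \<rho>(1)[OF x(1)] x(3) by simp
    qed
    moreover have "\<rho> (r / 2) - r / 2 < \<rho> r - r"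
    proof (rule DERIV_pos_imp_increasing_open[of "r / 2" r "\<lambda>x. \<rho> x - x"])
      show "\<exists>y. ((\<lambda>x. \<rho> x - x) has_real_derivative y) (at x) \<and> 0 < y" if "r / 2 < x" "x < r" for x
        using d[of x] gt[of x] that r by auto
      show "continuous_on {r / 2..r} (\<lambda>x. \<rho> x - x)"
        using d r by (intro DERIV_continuous_on[of _ _ "\<lambda>x. G x / H x - 1"])
          (auto intro: has_field_derivative_at_within)
    qed (use r in auto)
    ultimately show ?thesis by simp
  qed
  \<comment> \<open>Near \<open>0\<close> the fluxes are compared at equal heights through
    \<open>c * gam F powr p + j * f\<close>, whose derivative is \<open>gam F * (F' - j)\<close>.
    With \<open>h\<close> strictly between \<open>k * \<alpha> * a\<close> and
    \<open>\<alpha> * a\<close> this gives \<open>c * G powr p \<ge> h * (a - f)\<close> and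
    \<open>c * H powr p \<le> k * \<alpha> * a * (a - f)\<close>.\<close>
  obtain d where d: "0 < d" "\<And>r. 0 < r \<Longrightarrow> r < d \<Longrightarrow> 0 < D r"
  proof -
    define h where "h = (1 + k) / 2 * \<alpha> * a"
    define F' where "F' = (\<lambda>r. 1 * (\<alpha> * f r - \<beta> * r * gam (F r)) - gam (F r) powr q)"
    have "continuous_on {0..} F'" unfolding F'_def
      using sol_cont[OF s] q_pos by (intro continuous_intros continuous_on_powr') auto
    then have "continuous (at 0 within {0..}) F'" by (simp add: continuous_on_eq_continuous_within)
    moreover have F'0: "F' 0 = \<alpha> * a" using sol_0[OF s] by (simp add: F'_def gam_nonpos)
    moreover have h: "h < \<alpha> * a" "k * \<alpha> * a < h" using k alpha_pos a by (auto simp: h_def)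
    ultimately obtain d where d: "0 < d" "\<And>x. 0 \<le> x \<Longrightarrow> x < d \<Longrightarrow> \<bar>F' x - \<alpha> * a\<bar> < \<alpha> * a - h"
      unfolding continuous_within_eps_delta dist_real_def by (metis abs_of_nonneg atLeast_iff diff_gt_0_iff_gt diff_zero)
    have F'h: "h \<le> F' x" if "0 \<le> x" "x < d" for x using d(2)[OF that] by linarith
    define c where "c = (p - 1) / p"
    have c: "0 < c" using p1 by (simp add: c_def)
    have dp: "((\<lambda>r. c * gam (X r) powr p + j * x r) has_real_derivative gam (X r) * (X' - j)) (at r within {0..})"
      if "(X has_real_derivative X') (at r within {0..})"
        "(x has_real_derivative - gam (X r)) (at r within {0..})" for X X' x j r
    proof -
      have "c * (p / (p - 1) * gam (X r) powr (p + 1 - p) * X') + j * - gam (X r) = gam (X r) * (X' - j)"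
        using p1 by (simp add: c_def field_simps)
      moreover have "((\<lambda>r. c * gam (X r) powr p + j * x r) has_real_derivative
          c * (p / (p - 1) * gam (X r) powr (p + 1 - p) * X') + j * - gam (X r)) (at r within {0..})"
        by (intro DERIV_add DERIV_cmult DERIV_gam_powr that) simp
      ultimately show ?thesis by simp
    qed
    have "0 < D r" if r: "0 < r" "r < d" for r
    proof -
      have "c * gam (F 0) powr p + h * f 0 \<le> c * gam (F r) powr p + h * f r"
      proof (rule mono_Ici[OF dp[OF sol_F[OF s] sol_f[OF s]]])
        show "0 \<le> gam (F x) * (1 * (\<alpha> * f x - \<beta> * x * gam (F x)) - gam (F x) powr q - h)"
          if "0 < x" "x < r" for x
          using F'h[of x] that r by (intro mult_nonneg_nonneg) (auto simp: F'_def)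
      qed (use r in auto)
      then have "h * (a - f r) \<le> c * G r powr p"
        using sol_0[OF s] by (simp add: gam_nonpos G_def algebra_simps)
      moreover have "c * gam (\<Phi> (\<rho> r)) powr p + k * \<alpha> * a * \<phi> (\<rho> r) \<le>
          c * gam (\<Phi> 0) powr p + k * \<alpha> * a * \<phi> 0"
      proof (rule antimono_Ici[OF dp[OF sol_F[OF t] sol_f[OF t]]])
        fix x :: real assume x: "0 < x"
        have "k * (\<alpha> * \<phi> x - \<beta> * x * gam (\<Phi> x)) \<le> k * (\<alpha> * a)"
          using sol_le[OF t, of x] x k alpha_pos beta_pos
          by (intro mult_left_mono) (auto intro: add_increasing2 simp: diff_le_eq)
        then show "gam (\<Phi> x) * (k * (\<alpha> * \<phi> x - \<beta> * x * gam (\<Phi> x)) - gam (\<Phi> x) powr q - k * \<alpha> * a) \<le> 0"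
          using powr_ge_zero[of "gam (\<Phi> x)" q]
          by (intro mult_nonneg_nonpos) (simp_all add: mult.assoc del: powr_ge_zero)
      qed (use \<rho>(1)[OF r(1)] in auto)
      then have "c * H r powr p \<le> k * \<alpha> * a * (a - f r)"
        using sol_0[OF t] \<rho>(2)[OF r(1)] by (simp add: gam_nonpos H_def algebra_simps)
      moreover have "f r < a"
      proof -
        have "f r < f 0"
          by (rule DERIV_neg_imp_decreasing_open[OF r(1)])
            (use sol_f_at[OF s] GH continuous_on_subset[OF sol_cont(1)[OF s], of "{0..r}"] in
              \<open>force simp: G_def intro!: exI[of _ "- G _"]\<close>)+
        then show ?thesis using sol_0[OF s] by simp
      qed
      then have "k * \<alpha> * a * (a - f r) < h * (a - f r)" using h(2) by simp
      ultimately have "c * H r powr p < c * G r powr p" by linarith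
      then have "H r powr p < G r powr p" using c by simp
      then have "H r < G r"
        using powr_mono2[of p "G r" "H r"] GH[OF r(1)] p1 by force
      then show ?thesis unfolding G_def H_def D_def using gam_less_iff by simp
    qed
    then show thesis using that d(1) by blast
  qed
  \<comment> \<open>At a first zero \<open>u\<close> of the gap the third summand of
    \<open>D'\<close> vanishes, while \<open>\<rho> u > u\<close> makes the second one
    positive.\<close>
  have D: "0 < D r" if r: "0 < r" for r
  proof (cases "r < d")
    case False
    show ?thesis
    proof (rule pos_persists[of "d / 2" r D])
      show "continuous_on {d / 2..r} D"
        using dD d(1) by (intro DERIV_continuous_on[of _ _ D']) (auto intro: has_field_derivative_at_within)
      fix u assume u: "d / 2 < u" "u \<le> r" "D u = 0" and pos: "\<And>x. d / 2 \<le> x \<Longrightarrow> x < u \<Longrightarrow> 0 < D x"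
      have u0: "0 < u" using u d(1) by simp
      have "u < \<rho> u"
      proof (rule \<rho>_gt[OF u0])
        show "0 < D x" if "0 < x" "x < u" for x
          using d pos that by (cases "x < d / 2") auto
      qed
      then have "0 < k * \<beta> * (\<rho> u - u) * G u" using k beta_pos GH(1)[OF u0] by simp
      moreover have "G u = H u" using u(3) by (simp add: D_def G_def H_def)
      ultimately have "0 < D' u" using D'_ge[OF u0] u(3) by simp
      then show "\<exists>d>0. (D has_real_derivative d) (at u)" using dD[OF u0] by blast
    qed (use d False in auto)
  qed (use d r in auto)
  have \<rho>r: "r < \<rho> r" if "0 < r" for r using \<rho>_gt[OF that] D by blast

  \<comment> \<open>Decay rates and a positive lower bound for the gap at infinity\<close>
  define \<sigma> where "\<sigma> = \<mu> - q * (\<mu> + 1)"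
  have \<sigma>: "0 < \<sigma>" using q_mu_less by (simp add: \<sigma>_def)
  \<comment> \<open>As the scaled slope is nondecreasing and \<open>\<rho> r > r \<ge> 1\<close>,
    this bounds that of \<open>\<phi>\<close> at \<open>\<rho> r\<close> from below, hence
    \<open>1 / H\<close> from above.\<close>
  define y1 where "y1 = scaled_slope \<Phi> 1"
  have y1: "0 < y1" using Fp(2)[of 1] by (simp add: y1_def scaled_slope_def gam_pos)
  \<comment> \<open>For \<open>r \<ge> 1\<close>, \<open>r powr \<mu> * f r\<close> is at least
    \<open>f 1\<close> and \<open>\<rho> r powr \<mu> * f r\<close> at most \<open>K\<close>, so
    \<open>b\<close> bounds \<open>\<rho> r / r\<close>.\<close>
  define b where "b = (K / f 1) powr (1 / \<mu>)"
  have b: "0 < b" using K_pos fp[of 1] by (simp add: b_def)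
  have \<rho>_le: "\<rho> r \<le> b * r" if r: "1 \<le> r" for r
  proof -
    have "f 1 \<le> r powr \<mu> * f r"
      using Y_mono[OF s, of 1 r] E(1) r by simp
    then have "\<rho> r powr \<mu> * f 1 \<le> \<rho> r powr \<mu> * (r powr \<mu> * f r)" by (intro mult_left_mono) auto
    also have "\<dots> = r powr \<mu> * (\<rho> r powr \<mu> * \<phi> (\<rho> r))" using \<rho>(2)[of r] r by simp
    also have "\<dots> \<le> r powr \<mu> * K"
      using c' \<rho>(1)[of r] r by (intro mult_left_mono) (auto simp: critical_def)
    finally have "\<rho> r powr \<mu> \<le> K / f 1 * r powr \<mu>" using fp[of 1] by (simp add: field_simps)
    then have "(\<rho> r powr \<mu>) powr (1 / \<mu>) \<le> (K / f 1 * r powr \<mu>) powr (1 / \<mu>)"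
      using mu_pos by (intro powr_mono2) auto
    then show ?thesis
      using mu_pos \<rho>(1)[of r] r fp[of 1] K_pos by (simp add: powr_mult powr_powr b_def del: times_divide_eq_left)
  qed
  define N where "N = \<alpha> / (p - 1) * (K * slope_lim powr (2 - p) * (b powr (\<mu> + 1) / y1))"
  have N: "0 < N" using alpha_pos p1 K_pos slope_lim_pos b y1 by (simp add: N_def)
  \<comment> \<open>In the harmful summand \<open>G - H\<close> is at most a multiple of
    \<open>G powr (2 - p) * D\<close>. The rates of \<open>f\<close>, \<open>G\<close> and
    \<open>1 / H\<close> then combine, by \<open>mu_q\<close>, to the exponent
    \<open>- \<sigma> - 1\<close>.\<close>
  have D'_lower: "- (N * r powr (- \<sigma> - 1)) * D r \<le> D' r" if r: "1 \<le> r" for r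
  proof -
    have r0: "0 < r" using r by simp
    have HG: "H r \<le> G r" using D[OF r0] by (simp add: G_def H_def D_def gam_mono)
    have lip: "G r - H r \<le> 1 / (p - 1) * G r powr (2 - p) * D r"
    proof -
      have "1 / (p - 1) - 1 = (2 - p) / (p - 1)" using p1 by (simp add: field_simps)
      then show ?thesis
        using gam_lipschitz[of 1 "F r" "F r" "\<Phi> (\<rho> r)"] D[OF r0] Fp(1)[OF r0] p2 HG
        by (simp add: G_def H_def D_def gam_powr)
    qed
    have fK: "f r \<le> K * r powr (- \<mu>)"
      using c r0 by (auto simp: critical_def powr_minus field_simps)
    have "r powr (\<mu> + 1) * G r \<le> slope_lim"
      using critical_scaled_slope_le[OF s _ a c r0] by (simp add: scaled_slope_def G_def)
    then have GX: "G r \<le> slope_lim * r powr (- (\<mu> + 1))"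
      unfolding powr_minus_divide using r0 by (simp add: pos_le_divide_eq mult.commute)
    have Gp: "G r powr (2 - p) \<le> slope_lim powr (2 - p) * r powr (- (\<mu> + 1) * (2 - p))"
      using powr_mono2[OF _ _ GX, of "2 - p"] p2 GH(1)[OF r0] by (simp add: powr_mult powr_powr)
    have "y1 \<le> scaled_slope \<Phi> (\<rho> r)"
      unfolding y1_def by (rule critical_scaled_slope_mono[OF t k(1) a c']) (use \<rho>r[OF r0] r in auto)
    also have "\<dots> = \<rho> r powr (\<mu> + 1) * H r" by (simp add: scaled_slope_def H_def)
    also have "\<dots> \<le> (b * r) powr (\<mu> + 1) * H r"
      using \<rho>_le[OF r] \<rho>(1)[OF r0] mu_pos GH(2)[OF r0]
      by (intro mult_right_mono powr_mono2) auto
    finally have HY: "1 / H r \<le> b powr (\<mu> + 1) / y1 * r powr (\<mu> + 1)"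
      using y1 GH(2)[OF r0] b r0 by (simp add: powr_mult field_simps)
    have FG: "f r * G r powr (2 - p) \<le> K * r powr (- \<mu>) * (slope_lim powr (2 - p) * r powr (- (\<mu> + 1) * (2 - p)))"
      using fK Gp fp[of r] r0 K_pos by (intro mult_mono) auto
    have "f r * G r powr (2 - p) * (1 / H r) \<le>
        K * r powr (- \<mu>) * (slope_lim powr (2 - p) * r powr (- (\<mu> + 1) * (2 - p))) *
        (b powr (\<mu> + 1) / y1 * r powr (\<mu> + 1))"
      by (rule mult_mono[OF FG HY]) (use GH[OF r0] K_pos in auto)
    also have "\<dots> = K * slope_lim powr (2 - p) * (b powr (\<mu> + 1) / y1) *
        (r powr (- \<mu>) * r powr (- (\<mu> + 1) * (2 - p)) * r powr (\<mu> + 1))" by simp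
    also have "r powr (- \<mu>) * r powr (- (\<mu> + 1) * (2 - p)) * r powr (\<mu> + 1) = r powr (- \<sigma> - 1)"
    proof -
      have "- \<mu> + (- (\<mu> + 1) * (2 - p)) + (\<mu> + 1) = - \<sigma> - 1"
        using mu_q by (simp add: \<sigma>_def algebra_simps)
      then show ?thesis by (simp only: powr_add[symmetric])
    qed
    finally have "f r * G r powr (2 - p) * (1 / H r) \<le>
        K * slope_lim powr (2 - p) * (b powr (\<mu> + 1) / y1) * r powr (- \<sigma> - 1)" .
    from mult_left_mono[OF this, of "\<alpha> / (p - 1)"]
    have fGH: "\<alpha> / (p - 1) * (f r * G r powr (2 - p) * (1 / H r)) \<le> N * r powr (- \<sigma> - 1)"
      using alpha_pos p1 by (simp add: N_def mult.assoc)
    have "k * \<alpha> * f r * ((G r - H r) / H r) \<le> 1 * \<alpha> * f r * ((G r - H r) / H r)"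
      using k alpha_pos fp[of r] r0 GH[OF r0] HG by (intro mult_right_mono) auto
    also have "\<dots> \<le> 1 * \<alpha> * f r * ((1 / (p - 1) * G r powr (2 - p) * D r) / H r)"
      using lip alpha_pos fp[of r] r0 GH[OF r0] by (intro mult_left_mono divide_right_mono) auto
    also have "\<dots> = \<alpha> / (p - 1) * (f r * G r powr (2 - p) * (1 / H r)) * D r" by simp
    also have "\<dots> \<le> N * r powr (- \<sigma> - 1) * D r"
      using fGH D[OF r0] by (intro mult_right_mono) auto
    finally have "k * \<alpha> * f r * ((G r - H r) / H r) \<le> N * r powr (- \<sigma> - 1) * D r" .
    moreover have "0 \<le> k * \<beta> * (\<rho> r - r) * G r"
      using k beta_pos \<rho>r[OF r0] GH[OF r0] by (intro mult_nonneg_nonneg) auto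
    ultimately show ?thesis using D'_ge[OF r0] D[OF r0] by simp
  qed
  \<comment> \<open>An integrating factor. As \<open>r powr (- \<sigma> - 1)\<close> is integrable
    at infinity, it stays between \<open>e 1 > 0\<close> and \<open>1\<close> for
    \<open>r \<ge> 1\<close>; since \<open>D * e\<close> does not decrease, \<open>D\<close> stays
    away from \<open>0\<close>.\<close>
  define e where "e = (\<lambda>r. exp (- (N / \<sigma>) * r powr (- \<sigma>)))"
  have low: "D 1 * e 1 \<le> D r" if r: "1 \<le> r" for r
  proof -
    have "D 1 * e 1 \<le> D r * e r"
    proof (rule mono_pos[of "\<lambda>r. D r * e r" "\<lambda>r. (D' r + N * r powr (- \<sigma> - 1) * D r) * e r", OF _ _ _ r])
      fix x :: real assume x: "0 < x"
      have "((\<lambda>r. - (N / \<sigma>) * r powr (- \<sigma>)) has_real_derivative N * x powr (- \<sigma> - 1)) (at x)"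
        using DERIV_cmult[OF has_real_derivative_powr[OF x, of "- \<sigma>"], of "- (N / \<sigma>)"] \<sigma> by simp
      from DERIV_mult[OF dD[OF x] DERIV_chain2[OF DERIV_exp this]]
      show "((\<lambda>r. D r * e r) has_real_derivative (D' x + N * x powr (- \<sigma> - 1) * D x) * e x) (at x)"
        unfolding e_def by (rule DERIV_cong) (simp add: algebra_simps)
    next
      fix x :: real assume x: "1 < x"
      show "0 \<le> (D' x + N * x powr (- \<sigma> - 1) * D x) * e x"
        using D'_lower[of x] x by (intro mult_nonneg_nonneg) (auto simp: e_def)
    qed simp
    also have "\<dots> \<le> D r * 1"
      using D[of r] r N \<sigma> by (intro mult_left_mono) (auto simp: e_def)
    finally show ?thesis by simp
  qed
  \<comment> \<open>The bound on the scaled slope forces \<open>F\<close>, and with it the smaller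
    \<open>D\<close>, below \<open>D 1 * e 1\<close> for large \<open>r\<close>.\<close>
  have "((\<lambda>r. slope_lim powr (p - 1) * r powr (- ((\<mu> + 1) * (p - 1)))) \<longlongrightarrow> slope_lim powr (p - 1) * 0) at_top"
    using mu_pos p1 by (intro tendsto_intros tendsto_neg_powr filterlim_ident) auto
  moreover have "slope_lim powr (p - 1) * 0 < D 1 * e 1" using D[of 1] by (simp add: e_def)
  ultimately have "\<forall>\<^sub>F r in at_top. slope_lim powr (p - 1) * r powr (- ((\<mu> + 1) * (p - 1))) < D 1 * e 1"
    by (rule order_tendstoD(2))
  then have "\<forall>\<^sub>F r in at_top. (1::real) \<le> r \<and> slope_lim powr (p - 1) * r powr (- ((\<mu> + 1) * (p - 1))) < D 1 * e 1"
    using eventually_ge_at_top[of 1] by eventually_elim simp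
  then obtain r where r: "1 \<le> r" "slope_lim powr (p - 1) * r powr (- ((\<mu> + 1) * (p - 1))) < D 1 * e 1"
    using eventually_happens'[OF trivial_limit_at_top_linorder] by blast
  have r0: "0 < r" using r by simp
  have "D r \<le> F r" using Fp(2)[OF \<rho>(1)[OF r0]] by (simp add: D_def)
  also have "\<dots> = scaled_slope F r powr (p - 1) * r powr (- ((\<mu> + 1) * (p - 1)))"
    using scaled_slope_powr[of F r] Fp(1)[OF r0] r0 by (simp add: powr_minus)
  also have "\<dots> \<le> slope_lim powr (p - 1) * r powr (- ((\<mu> + 1) * (p - 1)))"
    using critical_scaled_slope_le[OF s _ a c r0] p1 scaled_slope_nonneg[of F r] by (intro mult_right_mono powr_mono2) auto
  finally show False using low[OF r(1)] r(2) by simp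
qed

text \<open>\<open>l\<close> makes the rescaled \<open>f\<close> start at \<open>b\<close>. From
  \<open>b > a\<close> follows \<open>l > 1\<close>, and \<open>q_mu_less\<close> makes the factor
  of its drift less than \<open>1\<close>; it takes the role of \<open>\<phi>\<close> against
  \<open>g\<close>.\<close>

lemma critical_not_less:
  assumes s: "sol 1 a f F" "0 < a" "critical f F" and t: "sol 1 b g G" "critical g G"
  shows "\<not> b > a"
proof
  assume ab: "a < b"
  define l where "l = (b / a) powr (1 / \<mu>)"
  have l: "1 < l" using ab s(2) mu_pos by (simp add: l_def gr_one_powr)
  have lm: "l powr \<mu> * a = b" using ab s(2) mu_pos by (simp add: l_def powr_powr)
  have k: "l powr (q * (\<mu> + 1) - \<mu>) < 1"
    using l q_mu_less by (simp add: powr_less_one)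
  show False
    by (rule critical_factor_contradiction[OF t(1) _ t(2) sol_scale(1)[OF s(1), of l, unfolded lm] _ k
        sol_scale(2)[OF s(1) _ s(3)]])
      (use ab s(2) l in auto)
qed

end

theorem theorem1p1:
  fixes p q :: real
  assumes "1 < p" and "p < 2" and "p - 1 < q" and "q < p / 2"
  shows "\<exists>!a. 0 < a \<and>
    (\<exists>f. global_solution p q a f \<and> (\<forall>r>0. f r > 0) \<and>
         f \<sim>[at_top] (\<lambda>r. K_star p q * r powr (- mu p q)))"
proof -
  interpret very_singular p q using assms by unfold_locales
  obtain a f F where a: "0 < a" and s: "sol 1 a f F" and c: "critical f F"
    using critical_exists by blast
  show ?thesis
  proof (rule ex1I[of _ a])
    show "0 < a \<and> (\<exists>f. global_solution p q a f \<and> (\<forall>r>0. f r > 0) \<and> f \<sim>[at_top] (\<lambda>r. K * r powr (- \<mu>)))"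
      using a sol_global_solution[OF s critical_F_pos[OF s _ a c]] sol_pos[OF s a] c
        critical_Y_tendsto[OF s _ a c] asymp_equiv_iff[of f]
      by (auto simp: critical_def intro!: exI[of _ f])
    fix b assume "0 < b \<and> (\<exists>f. global_solution p q b f \<and> (\<forall>r>0. f r > 0) \<and> f \<sim>[at_top] (\<lambda>r. K * r powr (- \<mu>)))"
    then obtain g where b: "0 < b" and g: "global_solution p q b g" "\<And>r. 0 < r \<Longrightarrow> 0 < g r"
      "((\<lambda>r. r powr \<mu> * g r) \<longlongrightarrow> K) at_top" using asymp_equiv_iff by blast
    obtain G where t: "sol 1 b g G" using global_solution_sol[OF g(1) b g(2)] .
    have c': "critical g G" by (rule tendsto_imp_critical[OF t _ b g(2,3)]) auto
    show "b = a"
      using critical_not_less[OF s a c t c'] critical_not_less[OF t b c' s c] by simp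
  qed
qed

end
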